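(* Let $q\in(0,1)$. The circle action $\mu$ of $U(1)$ on $C(S_q^7)$ defined on generators by $$\mu_w(z_j)=\begin{cases} wz_j, & j=1,4,\\ \overline{w}z_j, & j=2,3,\end{cases}\qquad w\in U(1),$$ is free.
   Context: The algebra $C(S_q^7)$, $q\in(0,1)$, is the universal $C^*$-algebra generated by $z_1,z_2,z_3,z_4$ subject to $$z_iz_j=qz_jz_i\ (i<j),\quad z_j^*z_i=qz_iz_j^*\ (i\ne j),\quad z_k^*z_k=z_kz_k^*+(1-q^2)\sum_{j<k}z_jz_j^*,\quad \sum_{k=1}^4z_kz_k^*=1.$$ Freeness (Ellwood): a coaction $\rho:A\to A\otimes C(G)$ of a compact quantum group on a $C^*$-algebra $A$ is free if the image of the linear map $$\Phi:A\otimes A\to A\otimes C(G),\qquad a_1\otimes a_2\mapsto (a_1\otimes 1)\rho(a_2),$$ is dense in $A\otimes C(G)$. An action of a compact group on a $C^*$-algebra is free if the corresponding coaction is free. For the circle action $\mu$, the corresponding coaction $\hat\mu:C(S_q^7)\to C(S_q^7)\otimes C(S^1)$ is the $*$-homomorphism with $\hat\mu(z_j)=z_j\otimes u$ for $j=1,4$ and $\hat\mu(z_j)=z_j\otimes u^*$ for $j=2,3$, where $u$ is the canonical unitary generator of $C(S^1)$. *)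

theory Defs
  imports "HOL-Analysis.Analysis" "HOL-Algebra.Module" "HOL-Library.Poly_Mapping"
begin

section \<open>Unital C*-algebras with explicit carrier\<close>

record 'a cstar = "(complex, 'a) module" +
  adj :: "'a \<Rightarrow> 'a"
  cnorm :: "'a \<Rightarrow> real"

definition complex_scalars :: "complex ring" where
  "complex_scalars = \<lparr>carrier = UNIV, mult = (*), one = 1, zero = 0, add = (+)\<rparr>"

definition cstar_algebra :: "('a, 'm) cstar_scheme \<Rightarrow> bool" where
  "cstar_algebra A \<longleftrightarrow>
     ring A \<and> Module.module complex_scalars A \<and>
     (\<forall>c. \<forall>x\<in>carrier A. \<forall>y\<in>carrier A.
        (c \<odot>\<^bsub>A\<^esub> x) \<otimes>\<^bsub>A\<^esub> y = c \<odot>\<^bsub>A\<^esub> (x \<otimes>\<^bsub>A\<^esub> y) \<and>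
        x \<otimes>\<^bsub>A\<^esub> (c \<odot>\<^bsub>A\<^esub> y) = c \<odot>\<^bsub>A\<^esub> (x \<otimes>\<^bsub>A\<^esub> y)) \<and>
     (\<forall>x\<in>carrier A. adj A x \<in> carrier A \<and> adj A (adj A x) = x) \<and>
     (\<forall>x\<in>carrier A. \<forall>y\<in>carrier A.
        adj A (x \<oplus>\<^bsub>A\<^esub> y) = adj A x \<oplus>\<^bsub>A\<^esub> adj A y \<and>
        adj A (x \<otimes>\<^bsub>A\<^esub> y) = adj A y \<otimes>\<^bsub>A\<^esub> adj A x) \<and>
     (\<forall>c. \<forall>x\<in>carrier A. adj A (c \<odot>\<^bsub>A\<^esub> x) = cnj c \<odot>\<^bsub>A\<^esub> adj A x) \<and>
     (\<forall>x\<in>carrier A. 0 \<le> cnorm A x \<and> (cnorm A x = 0 \<longleftrightarrow> x = \<zero>\<^bsub>A\<^esub>)) \<and>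
     (\<forall>c. \<forall>x\<in>carrier A. cnorm A (c \<odot>\<^bsub>A\<^esub> x) = cmod c * cnorm A x) \<and>
     (\<forall>x\<in>carrier A. \<forall>y\<in>carrier A.
        cnorm A (x \<oplus>\<^bsub>A\<^esub> y) \<le> cnorm A x + cnorm A y \<and>
        cnorm A (x \<otimes>\<^bsub>A\<^esub> y) \<le> cnorm A x * cnorm A y) \<and>
     (\<forall>x\<in>carrier A. cnorm A (adj A x \<otimes>\<^bsub>A\<^esub> x) = (cnorm A x)\<^sup>2) \<and>
     (\<forall>X. (\<forall>n::nat. X n \<in> carrier A) \<and>
          (\<forall>e>0. \<exists>M. \<forall>m\<ge>M. \<forall>n\<ge>M. cnorm A (X m \<ominus>\<^bsub>A\<^esub> X n) < e)
        \<longrightarrow> (\<exists>x\<in>carrier A. (\<lambda>n. cnorm A (X n \<ominus>\<^bsub>A\<^esub> x)) \<longlonglongrightarrow> 0))"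

text \<open>Unital *-homomorphisms (unitality is part of \<^const>\<open>ring_hom\<close>).\<close>

definition star_hom :: "('a, 'm) cstar_scheme \<Rightarrow> ('b, 'n) cstar_scheme \<Rightarrow> ('a \<Rightarrow> 'b) \<Rightarrow> bool" where
  "star_hom A B h \<longleftrightarrow> h \<in> ring_hom A B \<and>
     (\<forall>c. \<forall>x\<in>carrier A. h (c \<odot>\<^bsub>A\<^esub> x) = c \<odot>\<^bsub>B\<^esub> h x) \<and>
     (\<forall>x\<in>carrier A. h (adj A x) = adj B (h x))"

inductive_set lin_span :: "('a, 'm) cstar_scheme \<Rightarrow> 'a set \<Rightarrow> 'a set"
  for A :: "('a, 'm) cstar_scheme" (structure) and S :: "'a set" where
  lin_span_zero: "\<zero> \<in> lin_span A S"
| lin_span_step: "s \<in> S \<Longrightarrow> v \<in> lin_span A S \<Longrightarrow> (c \<odot> s) \<oplus> v \<in> lin_span A S"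

definition norm_closure :: "('a, 'm) cstar_scheme \<Rightarrow> 'a set \<Rightarrow> 'a set" where
  "norm_closure A S = {x \<in> carrier A. \<forall>e>0. \<exists>y\<in>S. cnorm A (x \<ominus>\<^bsub>A\<^esub> y) < e}"


section \<open>Universal C*-algebras given by generators and relations\<close>

text \<open>Words are lists of letters \<open>(g, b)\<close>, where \<open>(g, False)\<close> stands for the generator \<open>g\<close> and
  \<open>(g, True)\<close> for \<open>g\<^sup>*\<close>. With concatenation as the monoid operation on words, the finitely
  supported functions from words to the complex numbers, with the convolution product of
  \<^theory>\<open>HOL-Library.Poly_Mapping\<close>, form the free unital *-algebra on the generators.\<close>

instantiation list :: (type) monoid_add
begin
definition zero_list :: "'a list" where "zero_list = []"
definition plus_list :: "'a list \<Rightarrow> 'a list \<Rightarrow> 'a list" where "plus_list xs ys = xs @ ys"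
instance by standard (auto simp: zero_list_def plus_list_def)
end

type_synonym 'g free_star = "('g \<times> bool) list \<Rightarrow>\<^sub>0 complex"

definition free_gen :: "'g \<Rightarrow> 'g free_star" where
  "free_gen g = Poly_Mapping.single [(g, False)] 1"

definition free_scale :: "complex \<Rightarrow> 'g free_star \<Rightarrow> 'g free_star" where
  "free_scale c f = Poly_Mapping.single 0 c * f"

definition word_adj :: "('g \<times> bool) list \<Rightarrow> ('g \<times> bool) list" where
  "word_adj w = rev (map (\<lambda>(g, b). (g, \<not> b)) w)"

lemma word_adj_word_adj [simp]: "word_adj (word_adj w) = w"
  by (induction w) (auto simp: word_adj_def rev_map split_beta)

lift_definition free_adj :: "'g free_star \<Rightarrow> 'g free_star" is
  "\<lambda>f w. cnj (f (word_adj w))"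
proof -
  fix f :: "('g \<times> bool) list \<Rightarrow> complex"
  assume "finite {w. f w \<noteq> 0}"
  moreover have "{w. cnj (f (word_adj w)) \<noteq> 0} \<subseteq> word_adj ` {w. f w \<noteq> 0}"
    by (auto intro: image_eqI[where x = "word_adj w" for w])
  ultimately show "finite {w. cnj (f (word_adj w)) \<noteq> 0}"
    by (meson finite_imageI finite_subset)
qed

text \<open>The four conditions imply \<open>0 \<le> s f\<close> and \<open>s (f\<^sup>*) = s f\<close>; such \<open>s\<close> are exactly the
  functions \<open>f \<mapsto> \<parallel>\<pi>(f)\<parallel>\<close> for *-homomorphisms \<open>\<pi>\<close> into C*-algebras.\<close>

definition cstar_seminorm :: "('g free_star \<Rightarrow> real) \<Rightarrow> bool" where
  "cstar_seminorm s \<longleftrightarrow>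
     (\<forall>f g. s (f + g) \<le> s f + s g) \<and>
     (\<forall>c f. s (free_scale c f) = cmod c * s f) \<and>
     (\<forall>f g. s (f * g) \<le> s f * s g) \<and>
     (\<forall>f. s (free_adj f * f) = (s f)\<^sup>2)"

text \<open>The universal C*-seminorm for the relations \<open>r = 0\<close>, \<open>r \<in> R\<close>. As for every universal
  C*-algebra, it is meaningful only if the supremum is finite for every \<open>f\<close>; for the relations
  of the quantum sphere below it is.\<close>

definition univ_norm :: "'g free_star set \<Rightarrow> 'g free_star \<Rightarrow> real" where
  "univ_norm R f = Sup {s f | s. cstar_seminorm s \<and> (\<forall>r\<in>R. s r = 0)}"

text \<open>The universal unital C*-algebra is the separated completion of the free *-algebra for
  \<^const>\<open>univ_norm\<close>: its elements are the classes of Cauchy sequences modulo null sequences.\<close>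

definition univ_Cauchy :: "'g free_star set \<Rightarrow> (nat \<Rightarrow> 'g free_star) set" where
  "univ_Cauchy R = {X. \<forall>e>0. \<exists>M. \<forall>m\<ge>M. \<forall>n\<ge>M. univ_norm R (X m - X n) < e}"

definition univ_class :: "'g free_star set \<Rightarrow> (nat \<Rightarrow> 'g free_star) \<Rightarrow> (nat \<Rightarrow> 'g free_star) set" where
  "univ_class R X = {Y \<in> univ_Cauchy R. (\<lambda>n. univ_norm R (X n - Y n)) \<longlonglongrightarrow> 0}"

definition univ_cstar :: "'g free_star set \<Rightarrow> (nat \<Rightarrow> 'g free_star) set cstar" where
  "univ_cstar R = \<lparr>
     carrier = univ_class R ` univ_Cauchy R,
     mult = (\<lambda>a b. \<Union>X\<in>a. \<Union>Y\<in>b. univ_class R (\<lambda>n. X n * Y n)),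
     one = univ_class R (\<lambda>n. 1),
     zero = univ_class R (\<lambda>n. 0),
     add = (\<lambda>a b. \<Union>X\<in>a. \<Union>Y\<in>b. univ_class R (\<lambda>n. X n + Y n)),
     smult = (\<lambda>c a. \<Union>X\<in>a. univ_class R (\<lambda>n. free_scale c (X n))),
     adj = (\<lambda>a. \<Union>X\<in>a. univ_class R (\<lambda>n. free_adj (X n))),
     cnorm = (\<lambda>a. THE l. \<forall>X\<in>a. (\<lambda>n. univ_norm R (X n)) \<longlonglongrightarrow> l)\<rparr>"

definition univ_gen :: "'g free_star set \<Rightarrow> 'g \<Rightarrow> (nat \<Rightarrow> 'g free_star) set" where
  "univ_gen R g = univ_class R (\<lambda>n. free_gen g)"


section \<open>The quantum sphere\<close>

datatype gen = Z1 | Z2 | Z3 | Z4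

fun idx :: "gen \<Rightarrow> nat" where
  "idx Z1 = 1" | "idx Z2 = 2" | "idx Z3 = 3" | "idx Z4 = 4"

instance gen :: finite
proof
  have "(UNIV :: gen set) = {Z1, Z2, Z3, Z4}"
    using gen.exhaust by blast
  then show "finite (UNIV :: gen set)"
    by (metis finite.emptyI finite_insert)
qed

definition sphere7_relators :: "real \<Rightarrow> gen free_star set" where
  "sphere7_relators q =
     (let z = free_gen; zs = (\<lambda>j. free_adj (free_gen j)) in
       {z i * z j - free_scale (of_real q) (z j * z i) | i j. idx i < idx j} \<union>
       {zs j * z i - free_scale (of_real q) (z i * zs j) | i j. i \<noteq> j} \<union>
       {zs k * z k - (z k * zs k +
          free_scale (of_real (1 - q\<^sup>2)) (\<Sum>j\<in>{j. idx j < idx k}. z j * zs j)) | k. True} \<union>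
       {(\<Sum>k\<in>UNIV. z k * zs k) - 1})"

definition C_sphere7 :: "real \<Rightarrow> (nat \<Rightarrow> gen free_star) set cstar" where
  "C_sphere7 q = univ_cstar (sphere7_relators q)"

definition zgen :: "real \<Rightarrow> gen \<Rightarrow> (nat \<Rightarrow> gen free_star) set" where
  "zgen q j = univ_gen (sphere7_relators q) j"


section \<open>The tensor product with \<open>C(X)\<close>\<close>

text \<open>\<open>A \<otimes> C(X)\<close> for compact \<open>X\<close>: since \<open>C(X)\<close> is nuclear there is only one C*-norm on the
  algebraic tensor product, namely the supremum norm of \<open>\<Sum> a\<^sub>i \<otimes> f\<^sub>i\<close> regarded as the function
  \<open>x \<mapsto> \<Sum> f\<^sub>i(x) a\<^sub>i\<close>. The tensor product is thus the closed linear span of the elementary tensors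
  inside the algebra of bounded functions from \<open>X\<close> to \<open>A\<close>.\<close>

definition bounded_functions :: "('a, 'm) cstar_scheme \<Rightarrow> 'x set \<Rightarrow> ('x \<Rightarrow> 'a) cstar" where
  "bounded_functions A X = \<lparr>
     carrier = {F \<in> X \<rightarrow>\<^sub>E carrier A. bdd_above ((\<lambda>x. cnorm A (F x)) ` X)},
     mult = (\<lambda>F G. \<lambda>x\<in>X. F x \<otimes>\<^bsub>A\<^esub> G x),
     one = (\<lambda>x\<in>X. \<one>\<^bsub>A\<^esub>),
     zero = (\<lambda>x\<in>X. \<zero>\<^bsub>A\<^esub>),
     add = (\<lambda>F G. \<lambda>x\<in>X. F x \<oplus>\<^bsub>A\<^esub> G x),
     smult = (\<lambda>c F. \<lambda>x\<in>X. c \<odot>\<^bsub>A\<^esub> F x),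
     adj = (\<lambda>F. \<lambda>x\<in>X. adj A (F x)),
     cnorm = (\<lambda>F. SUP x\<in>X. cnorm A (F x))\<rparr>"

definition elem_tensor ::
  "('a, 'm) cstar_scheme \<Rightarrow> 'x set \<Rightarrow> 'a \<Rightarrow> ('x \<Rightarrow> complex) \<Rightarrow> 'x \<Rightarrow> 'a" where
  "elem_tensor A X a f = (\<lambda>x\<in>X. f x \<odot>\<^bsub>A\<^esub> a)"

definition tensor_C ::
  "('a, 'm) cstar_scheme \<Rightarrow> 'x::topological_space set \<Rightarrow> ('x \<Rightarrow> 'a) cstar" where
  "tensor_C A X = (bounded_functions A X)
     \<lparr>carrier := norm_closure (bounded_functions A X)
        (lin_span (bounded_functions A X)
          {elem_tensor A X a f | a f. a \<in> carrier A \<and> continuous_on X f})\<rparr>"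


section \<open>Circle actions, coactions of \<open>C(S\<^sup>1)\<close> and freeness\<close>

abbreviation U1 :: "complex set" where "U1 \<equiv> sphere 0 1"

text \<open>Each \<open>\<mu> w\<close> is an automorphism, with inverse \<open>\<mu> (inverse w)\<close> by the group law.\<close>

definition circle_action :: "('a, 'm) cstar_scheme \<Rightarrow> (complex \<Rightarrow> 'a \<Rightarrow> 'a) \<Rightarrow> bool" where
  "circle_action A \<mu> \<longleftrightarrow> cstar_algebra A \<and>
     (\<forall>w\<in>U1. star_hom A A (\<mu> w)) \<and>
     (\<forall>a\<in>carrier A. \<mu> 1 a = a) \<and>
     (\<forall>v\<in>U1. \<forall>w\<in>U1. \<forall>a\<in>carrier A. \<mu> (v * w) a = \<mu> v (\<mu> w a)) \<and>
     (\<forall>a\<in>carrier A. \<forall>w\<in>U1.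
        ((\<lambda>v. cnorm A (\<mu> v a \<ominus>\<^bsub>A\<^esub> \<mu> w a)) \<longlongrightarrow> 0) (at w within U1))"

text \<open>A coaction of \<open>C(S\<^sup>1)\<close> is a unital *-homomorphism \<open>\<rho> : A \<rightarrow> A \<otimes> C(S\<^sup>1)\<close> satisfying
  \<open>(id \<otimes> \<epsilon>) \<circ> \<rho> = id\<close> and \<open>(\<rho> \<otimes> id) \<circ> \<rho> = (id \<otimes> \<Delta>) \<circ> \<rho>\<close>, where \<open>\<epsilon>(f) = f(1)\<close> and
  \<open>\<Delta>(f)(v, w) = f(v w)\<close>; the second identity is evaluated at the points \<open>(v, w)\<close>.\<close>

definition circle_coaction ::
  "('a, 'm) cstar_scheme \<Rightarrow> ('a \<Rightarrow> complex \<Rightarrow> 'a) \<Rightarrow> bool" where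
  "circle_coaction A \<rho> \<longleftrightarrow> cstar_algebra A \<and>
     star_hom A (tensor_C A U1) \<rho> \<and>
     (\<forall>a\<in>carrier A. \<rho> a 1 = a) \<and>
     (\<forall>a\<in>carrier A. \<forall>v\<in>U1. \<forall>w\<in>U1. \<rho> (\<rho> a w) v = \<rho> a (v * w))"

text \<open>The image of the linear map \<open>\<Phi>\<close> on \<open>A \<otimes> A\<close> is the linear span of the images
  \<open>(a \<otimes> 1) \<rho>(b)\<close> of the elementary tensors \<open>a \<otimes> b\<close>.\<close>

definition ellwood_image ::
  "('a, 'm) cstar_scheme \<Rightarrow> ('a \<Rightarrow> complex \<Rightarrow> 'a) \<Rightarrow> (complex \<Rightarrow> 'a) set" where
  "ellwood_image A \<rho> = lin_span (tensor_C A U1)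
     {elem_tensor A U1 a (\<lambda>_. 1) \<otimes>\<^bsub>tensor_C A U1\<^esub> \<rho> b | a b. a \<in> carrier A \<and> b \<in> carrier A}"

definition free_coaction ::
  "('a, 'm) cstar_scheme \<Rightarrow> ('a \<Rightarrow> complex \<Rightarrow> 'a) \<Rightarrow> bool" where
  "free_coaction A \<rho> \<longleftrightarrow> circle_coaction A \<rho> \<and>
     norm_closure (tensor_C A U1) (ellwood_image A \<rho>) = carrier (tensor_C A U1)"

definition coaction_of ::
  "(complex \<Rightarrow> 'a \<Rightarrow> 'a) \<Rightarrow> 'a \<Rightarrow> complex \<Rightarrow> 'a" where
  "coaction_of \<mu> a = (\<lambda>w\<in>U1. \<mu> w a)"

definition free_circle_action ::
  "('a, 'm) cstar_scheme \<Rightarrow> (complex \<Rightarrow> 'a \<Rightarrow> 'a) \<Rightarrow> bool" where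
  "free_circle_action A \<mu> \<longleftrightarrow> circle_action A \<mu> \<and> free_coaction A (coaction_of \<mu>)"

definition sphere7_action :: "real \<Rightarrow> (complex \<Rightarrow> (nat \<Rightarrow> gen free_star) set \<Rightarrow>
    (nat \<Rightarrow> gen free_star) set) \<Rightarrow> bool" where
  "sphere7_action q \<mu> \<longleftrightarrow> circle_action (C_sphere7 q) \<mu> \<and>
     (\<forall>w\<in>U1. \<forall>j. \<mu> w (zgen q j) =
        (if j \<in> {Z1, Z4} then w \<odot>\<^bsub>C_sphere7 q\<^esub> zgen q j
         else cnj w \<odot>\<^bsub>C_sphere7 q\<^esub> zgen q j))"

text \<open>On the generators the associated coaction is \<open>z\<^sub>j \<mapsto> z\<^sub>j \<otimes> u\<close> for \<open>j = 1, 4\<close> and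
  \<open>z\<^sub>j \<mapsto> z\<^sub>j \<otimes> u\<^sup>*\<close> for \<open>j = 2, 3\<close>, where \<open>u(w) = w\<close>.\<close>

lemma coaction_of_sphere7_action:
  assumes "sphere7_action q \<mu>"
  shows "coaction_of \<mu> (zgen q j) =
    elem_tensor (C_sphere7 q) U1 (zgen q j) (if j \<in> {Z1, Z4} then (\<lambda>w. w) else cnj)"
  using assms unfolding sphere7_action_def coaction_of_def elem_tensor_def
  by (auto intro!: restrict_ext)

end

theory Submission
  imports Defs
begin

text \<open>The span \<open>E\<close> of the functions \<open>w \<mapsto> a \<mu>\<^sub>w(b)\<close> is stable under left multiplication by elements of
  the algebra and under right multiplication by orbit functions \<open>w \<mapsto> \<mu>\<^sub>w(b)\<close>. Hence the scalar
  functions in \<open>E\<close> form an algebra, and by the Stone--Weierstrass theorem \<open>E\<close> is dense as soon as it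
  contains \<open>u\<close> and \<open>u\<^sup>*\<close>. These two lie in \<open>E\<close> because of the identities
  \<open>q\<^sup>2 (z\<^sub>1\<^sup>* z\<^sub>1 + z\<^sub>2 z\<^sub>2\<^sup>* + z\<^sub>3 z\<^sub>3\<^sup>*) + z\<^sub>4\<^sup>* z\<^sub>4 = 1\<close> and
  \<open>q\<^sup>4 z\<^sub>1 z\<^sub>1\<^sup>* + q\<^sup>2 z\<^sub>2\<^sup>* z\<^sub>2 + z\<^sub>3\<^sup>* z\<^sub>3 + z\<^sub>4 z\<^sub>4\<^sup>* = 1\<close>: in each summand the right factor has
  weight \<open>1\<close> in the first and weight \<open>-1\<close> in the second identity.\<close>

section \<open>The free unital *-algebra\<close>

text \<open>The sphere relation alone does not give \<open>u\<close> and \<open>u\<^sup>*\<close>: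
  in \<open>z\<^sub>1 z\<^sub>1\<^sup>* + ... + z\<^sub>4 z\<^sub>4\<^sup>* = 1\<close> the right
  factors \<open>z\<^sub>1\<^sup>*\<close>, \<open>z\<^sub>4\<^sup>*\<close> have weight -1 and
  \<open>z\<^sub>2\<^sup>*\<close>, \<open>z\<^sub>3\<^sup>*\<close> have weight 1. Each of the two
  identities reverses the two products of the wrong weight, and the powers of \<open>q\<close>
  absorb the terms which the relations for \<open>z\<^sub>k\<^sup>* z\<^sub>k\<close> bring in. If
  every \<open>b\<^sub>i\<close> in an identity \<open>\<Sum> a\<^sub>i b\<^sub>i = 1\<close> has
  weight 1, then \<open>\<Sum> a\<^sub>i \<mu>\<^sub>w(b\<^sub>i) = w\<close>. The remaining work
  comes from the algebra being a completion for a supremum of seminorms. The supremum has to be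
  shown finite, through bounds on the generators, before the completion is a C*-algebra, and the
  action has to be constructed. It starts on the free *-algebra, where rescaling the generators is a
  *-endomorphism, and it descends because rescaling by numbers of modulus one multiplies each
  relator by a scalar.\<close>

lemma free_star_induct [case_names single add]:
  assumes single: "\<And>w c. P (Poly_Mapping.single w c)"
    and add: "\<And>f g. P f \<Longrightarrow> P g \<Longrightarrow> P (f + g)"
  shows "P (f :: 'g free_star)"
proof (induction f rule: update_induct)
  case const
  show ?case using single[of 0 0] by simp
next
  case (update f w c)
  have "Poly_Mapping.update w c f = Poly_Mapping.single w c + f"
    using update.hyps
    by (intro poly_mapping_eqI) (auto simp: lookup_update lookup_add lookup_single in_keys_iff when_def)
  then show ?case using add single update by metis
qed

lemma free_scale_add_right: "free_scale c (f + g) = free_scale c f + free_scale c g"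
  and free_scale_add_left: "free_scale (c + d) f = free_scale c f + free_scale d f"
  and free_scale_scale: "free_scale c (free_scale d f) = free_scale (c * d) f"
  and free_scale_mult_left: "free_scale c f * g = free_scale c (f * g)"
  and free_scale_diff_right: "free_scale c (f - g) = free_scale c f - free_scale c g"
  by (simp_all add: free_scale_def single_add single_diff algebra_simps mult_single flip: mult.assoc)

lemma free_scale_one [simp]: "free_scale 1 f = f"
  by (simp add: free_scale_def)

lemma free_scale_zero [simp]: "free_scale 0 f = 0" "free_scale c 0 = 0"
  by (simp_all add: free_scale_def)

lemma free_scale_minus_one: "free_scale (-1) f = - f"
  by (simp add: free_scale_def single_uminus)

lemma free_scale_single: "free_scale c (Poly_Mapping.single w d) = Poly_Mapping.single w (c * d)"
  by (simp add: free_scale_def mult_single)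

lemma lookup_free_scale: "Poly_Mapping.lookup (free_scale c f) w = c * Poly_Mapping.lookup f w"
  by (induction f rule: free_star_induct)
     (auto simp: free_scale_single lookup_single when_def free_scale_add_right lookup_add algebra_simps)

text \<open>Scaling is left multiplication by a constant sitting at the empty word, so the point is
  that such constants are central: the empty word is neutral on both sides, and complex numbers
  commute.\<close>

lemma free_scale_mult_right: "f * free_scale c g = free_scale c (f * g)"
proof -
  have "f * Poly_Mapping.single 0 c = Poly_Mapping.single 0 c * f"
    by (induction f rule: free_star_induct) (simp_all add: mult_single algebra_simps)
  then show ?thesis by (metis free_scale_def mult.assoc)
qed

lemma free_adj_add: "free_adj (f + g) = free_adj f + free_adj g"
  by (intro poly_mapping_eqI) (simp add: free_adj.rep_eq lookup_add)

lemma free_adj_adj [simp]: "free_adj (free_adj f) = f"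
  by (intro poly_mapping_eqI) (simp add: free_adj.rep_eq)

lemma word_adj_append: "word_adj (v + w) = word_adj w + word_adj v"
  by (simp add: word_adj_def plus_list_def)

lemma word_adj_zero [simp]: "word_adj 0 = 0"
  by (simp add: word_adj_def zero_list_def)

lemma free_adj_single: "free_adj (Poly_Mapping.single w c) = Poly_Mapping.single (word_adj w) (cnj c)"
  by (intro poly_mapping_eqI) (auto simp: free_adj.rep_eq lookup_single when_def)

lemma free_adj_mult: "free_adj (f * g) = free_adj g * free_adj f"
proof (induction f rule: free_star_induct)
  case (single v c)
  show ?case
    by (induction g rule: free_star_induct)
       (simp_all add: mult_single free_adj_single word_adj_append free_adj_add algebra_simps)
qed (simp add: free_adj_add algebra_simps)

lemma free_adj_scale: "free_adj (free_scale c f) = free_scale (cnj c) (free_adj f)"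
  by (intro poly_mapping_eqI) (simp add: free_adj.rep_eq lookup_free_scale)

lemma free_adj_diff: "free_adj (f - g) = free_adj f - free_adj g"
  by (intro poly_mapping_eqI) (simp add: free_adj.rep_eq lookup_minus)

lemma free_adj_one [simp]: "free_adj 1 = 1"
  using free_adj_single[of 0 1] by (simp only: single_one word_adj_zero complex_cnj_one)

section \<open>Gauge endomorphisms of the free *-algebra\<close>

definition word_weight :: "('g \<Rightarrow> complex) \<Rightarrow> ('g \<times> bool) list \<Rightarrow> complex" where
  "word_weight u w = (\<Prod>(g, b)\<leftarrow>w. if b then cnj (u g) else u g)"

lemma word_weight_zero [simp]: "word_weight u 0 = 1"
  and word_weight_add: "word_weight u (v + w) = word_weight u v * word_weight u w"
  by (simp_all add: word_weight_def zero_list_def plus_list_def)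

lemma word_weight_adj: "word_weight u (word_adj w) = cnj (word_weight u w)"
  by (induction w) (auto simp: word_weight_def word_adj_def split: if_splits)

lemma word_weight_const_one [simp]: "word_weight (\<lambda>_. 1) w = 1"
  by (induction w) (auto simp: word_weight_def)

lemma word_weight_times: "word_weight (\<lambda>g. u g * v g) w = word_weight u w * word_weight v w"
  by (induction w) (auto simp: word_weight_def split: if_splits)

text \<open>The *-endomorphism with \<open>g \<mapsto> u g \<cdot> g\<close>, written as a diagonal
  operator in the basis of words. Multiplicativity and compatibility with the involution come from
  \<open>word_weight\<close> being multiplicative on words and conjugated by
  \<open>word_adj\<close>. Modulus one of \<open>u\<close> enters only with the relations.\<close>

lift_definition gauge :: "('g \<Rightarrow> complex) \<Rightarrow> 'g free_star \<Rightarrow> 'g free_star" is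
  "\<lambda>u f w. word_weight u w * f w"
  by (erule rev_finite_subset) auto

lemma gauge_single: "gauge u (Poly_Mapping.single w c) = Poly_Mapping.single w (word_weight u w * c)"
  by (intro poly_mapping_eqI) (auto simp: gauge.rep_eq lookup_single when_def)

lemma gauge_add: "gauge u (f + g) = gauge u f + gauge u g"
  and gauge_diff: "gauge u (f - g) = gauge u f - gauge u g"
  and gauge_scale: "gauge u (free_scale c f) = free_scale c (gauge u f)"
  and gauge_adj: "gauge u (free_adj f) = free_adj (gauge u f)"
  and gauge_const_one [simp]: "gauge (\<lambda>_. 1) f = f"
  and gauge_gauge: "gauge u (gauge v f) = gauge (\<lambda>g. u g * v g) f"
  by (intro poly_mapping_eqI; simp add: gauge.rep_eq lookup_add lookup_minus lookup_free_scale
        free_adj.rep_eq word_weight_adj word_weight_times algebra_simps)+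

lemma gauge_mult: "gauge u (f * g) = gauge u f * gauge u g"
proof (induction f rule: free_star_induct)
  case (single v c)
  show ?case
    by (induction g rule: free_star_induct)
       (simp_all add: mult_single gauge_single word_weight_add gauge_add algebra_simps)
qed (simp add: gauge_add algebra_simps)

lemma gauge_zero [simp]: "gauge u 0 = 0"
  using gauge_add[of u 0 0] by simp

lemma gauge_one [simp]: "gauge u 1 = 1"
  using gauge_single[of u 0 1] by simp

lemma gauge_sum: "gauge u (\<Sum>i\<in>I. f i) = (\<Sum>i\<in>I. gauge u (f i))"
  by (induction I rule: infinite_finite_induct) (auto simp: gauge_add)

lemma gauge_gen: "gauge u (free_gen g) = free_scale (u g) (free_gen g)"
  by (simp add: free_gen_def gauge_single free_scale_single word_weight_def)

section \<open>C*-seminorms\<close>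

lemma cstar_seminormD:
  assumes "cstar_seminorm s"
  shows "s (f + g) \<le> s f + s g" "s (free_scale c f) = cmod c * s f" "s (f * g) \<le> s f * s g"
    "s (free_adj f * f) = (s f)\<^sup>2"
  using assms by (auto simp: cstar_seminorm_def)

lemma
  assumes "cstar_seminorm s"
  shows cstar_seminorm_zero: "s 0 = 0"
    and cstar_seminorm_minus: "s (- f) = s f"
    and cstar_seminorm_nonneg: "0 \<le> s f"
    and cstar_seminorm_diff: "s (f - g) \<le> s f + s g"
    and cstar_seminorm_commute: "s (f - g) = s (g - f)"
    and cstar_seminorm_abs_diff: "\<bar>s f - s g\<bar> \<le> s (f - g)"
proof -
  note s = cstar_seminormD[OF assms]
  show zero: "s 0 = 0" using s(2)[of 0 0] by simp
  show minus: "s (- f) = s f" for f using s(2)[of "-1" f] by (simp add: free_scale_minus_one)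
  show "0 \<le> s f" using s(1)[of f "- f"] zero minus[of f] by simp
  show "s (f - g) \<le> s f + s g" using s(1)[of f "- g"] minus[of g] by simp
  show c: "s (f - g) = s (g - f)" for f g using minus[of "f - g"] by simp
  show "\<bar>s f - s g\<bar> \<le> s (f - g)"
    using s(1)[of "f - g" g] s(1)[of "g - f" f] c[of f g] by simp
qed

text \<open>The C*-identity and submultiplicativity give
  \<open>s f * s f \<le> s (free_adj f) * s f\<close>. Cancelling \<open>s f\<close> yields one
  inequality, and replacing \<open>f\<close> by its adjoint yields the other.\<close>

lemma cstar_seminorm_adj:
  assumes "cstar_seminorm s"
  shows "s (free_adj f) = s f"
proof -
  note s = cstar_seminormD[OF assms] and nn = cstar_seminorm_nonneg[OF assms]
  have le: "s f \<le> s (free_adj f)" for f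
  proof (cases "s f = 0")
    case False
    have "s f * s f \<le> s (free_adj f) * s f"
      using s(3)[of "free_adj f" f] s(4)[of f] by (simp add: power2_eq_square)
    then show ?thesis using False nn[of f] by (simp add: mult_le_cancel_right)
  qed (simp add: nn)
  show ?thesis using le[of f] le[of "free_adj f"] by simp
qed

lemma cstar_seminorm_adj_right:
  assumes "cstar_seminorm s"
  shows "s (f * free_adj f) = (s f)\<^sup>2"
  using cstar_seminormD(4)[OF assms, of "free_adj f"] cstar_seminorm_adj[OF assms, of f] by simp

text \<open>Since \<open>1\<close> is self-adjoint and idempotent, the C*-identity reads
  \<open>s 1 = (s 1)\<^sup>2\<close>, so the value is 0 or 1; the value 0 occurs for the zero
  seminorm.\<close>

lemma cstar_seminorm_one:
  assumes "cstar_seminorm s"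
  shows "s 1 \<le> 1"
  using cstar_seminormD(4)[OF assms, of 1] by (auto simp: power2_eq_square)

lemma cstar_seminorm_gauge:
  assumes "cstar_seminorm s"
  shows "cstar_seminorm (\<lambda>f. s (gauge u f))"
  unfolding cstar_seminorm_def
  by (auto simp: gauge_add gauge_scale gauge_mult gauge_adj cstar_seminormD[OF assms])

text \<open>The zero seminorm satisfies all relations; it makes the set in \<open>univ_norm\<close>
  nonempty and bounds the supremum below by 0.\<close>

lemma cstar_seminorm_const_zero: "cstar_seminorm (\<lambda>_. 0)"
  by (simp add: cstar_seminorm_def)

section \<open>Bounds that are uniform over all seminorms\<close>

definition word_bound :: "('g \<Rightarrow> real) \<Rightarrow> ('g \<times> bool) list \<Rightarrow> real" where
  "word_bound B w = (\<Prod>(g, b)\<leftarrow>w. B g)"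

lemma cstar_seminorm_word:
  assumes s: "cstar_seminorm s" and B: "\<And>g. s (free_gen g) \<le> B g"
  shows "s (Poly_Mapping.single w 1) \<le> word_bound B w"
proof (induction w)
  case Nil
  have "Poly_Mapping.single [] 1 = (1 :: 'a free_star)"
    by (simp flip: zero_list_def)
  then show ?case
    using cstar_seminorm_one[OF s] by (simp add: word_bound_def)
next
  case (Cons x w)
  obtain g b where x: "x = (g, b)" by fastforce
  have B0: "0 \<le> B g" using B[of g] cstar_seminorm_nonneg[OF s, of "free_gen g"] by linarith
  have "Poly_Mapping.single [(g, True)] 1 = free_adj (free_gen g)"
    by (simp add: free_gen_def free_adj_single word_adj_def)
  then have letter: "s (Poly_Mapping.single [x] 1) \<le> B g"
    using B[of g] cstar_seminorm_adj[OF s, of "free_gen g"]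
    by (cases b) (auto simp: x free_gen_def)
  have "Poly_Mapping.single (x # w) (1::complex) = Poly_Mapping.single [x] 1 * Poly_Mapping.single w 1"
    by (simp add: mult_single plus_list_def)
  then have "s (Poly_Mapping.single (x # w) 1) \<le> s (Poly_Mapping.single [x] 1) * s (Poly_Mapping.single w 1)"
    using cstar_seminormD(3)[OF s] by metis
  also have "\<dots> \<le> B g * word_bound B w"
    using letter Cons B0 by (intro mult_mono) (auto intro: cstar_seminorm_nonneg[OF s])
  finally show ?case by (simp add: word_bound_def x)
qed

text \<open>The order of quantifiers matters: \<open>C\<close> depends on \<open>f\<close> but not
  on \<open>s\<close>, which is what finiteness of a supremum over seminorms requires.
  Submultiplicativity settles monomials, and the triangle inequality settles their sums.\<close>

lemma cstar_seminorm_bounded: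
  "\<exists>C. \<forall>s. cstar_seminorm s \<and> (\<forall>g. s (free_gen g) \<le> B g) \<longrightarrow> s f \<le> C"
proof (induction f rule: free_star_induct)
  case (single w c)
  show ?case
  proof (intro exI[of _ "cmod c * word_bound B w"] allI impI, elim conjE)
    fix s :: "'a free_star \<Rightarrow> real" assume s: "cstar_seminorm s" and B: "\<forall>g. s (free_gen g) \<le> B g"
    have "s (Poly_Mapping.single w c) = cmod c * s (Poly_Mapping.single w 1)"
      using cstar_seminormD(2)[OF s, of c "Poly_Mapping.single w 1"] by (simp add: free_scale_single)
    also have "\<dots> \<le> cmod c * word_bound B w"
      using cstar_seminorm_word[OF s] B by (intro mult_left_mono) auto
    finally show "s (Poly_Mapping.single w c) \<le> cmod c * word_bound B w" .
  qed
next
  case (add f g)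
  then obtain C D where
    "\<forall>s. cstar_seminorm s \<and> (\<forall>g. s (free_gen g) \<le> B g) \<longrightarrow> s f \<le> C"
    "\<forall>s. cstar_seminorm s \<and> (\<forall>g. s (free_gen g) \<le> B g) \<longrightarrow> s g \<le> D" by auto
  then show ?case
    by (intro exI[of _ "C + D"]) (meson add_mono cstar_seminormD(1) order_trans)
qed

section \<open>The universal C*-seminorm\<close>

lemma univ_norm_upper:
  assumes bd: "\<And>f. \<exists>C. \<forall>s. cstar_seminorm s \<and> (\<forall>r\<in>R. s r = 0) \<longrightarrow> s f \<le> C"
    and "cstar_seminorm s" "\<forall>r\<in>R. s r = 0"
  shows "s f \<le> univ_norm R f"
  unfolding univ_norm_def
proof (rule cSup_upper)
  show "bdd_above {s f |s. cstar_seminorm s \<and> (\<forall>r\<in>R. s r = 0)}"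
    using bd[of f] by (auto simp: bdd_above_def)
qed (use assms in auto)

lemma univ_norm_least:
  assumes "\<And>s. cstar_seminorm s \<Longrightarrow> \<forall>r\<in>R. s r = 0 \<Longrightarrow> s f \<le> C"
  shows "univ_norm R f \<le> C"
  unfolding univ_norm_def
  by (rule cSup_least) (use assms cstar_seminorm_const_zero in blast)+

text \<open>Inequalities pass to a pointwise supremum at once. The two equalities need a converse
  estimate: homogeneity is recovered by scaling back with \<open>1 / c\<close>, and the C*-identity
  by taking square roots before the supremum.\<close>

lemma cstar_seminorm_univ_norm:
  assumes bd: "\<And>f. \<exists>C. \<forall>s. cstar_seminorm s \<and> (\<forall>r\<in>R. s r = 0) \<longrightarrow> s f \<le> C"
  shows "cstar_seminorm (univ_norm R)"
proof -
  note up = univ_norm_upper[OF bd]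
  have nn: "0 \<le> univ_norm R f" for f by (rule up[OF cstar_seminorm_const_zero]) simp
  have scale_le: "univ_norm R (free_scale c f) \<le> cmod c * univ_norm R f" for c f
    by (rule univ_norm_least) (auto simp: cstar_seminormD intro!: mult_left_mono up)
  show ?thesis
    unfolding cstar_seminorm_def
  proof (intro conjI allI)
    fix f g :: "'a free_star" and c
    show "univ_norm R (f + g) \<le> univ_norm R f + univ_norm R g"
      by (rule univ_norm_least) (meson add_mono cstar_seminormD(1) order_trans up)
    show "univ_norm R (free_scale c f) = cmod c * univ_norm R f"
    proof (cases "c = 0")
      case True
      then show ?thesis using nn[of 0] scale_le[of 0 0] by simp
    next
      case False
      have "univ_norm R f \<le> cmod (1 / c) * univ_norm R (free_scale c f)"
        using scale_le[of "1 / c" "free_scale c f"] False by (simp add: free_scale_scale)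
      then have "cmod c * univ_norm R f \<le> univ_norm R (free_scale c f)"
        using False by (simp add: norm_divide field_simps)
      then show ?thesis using scale_le[of c f] by simp
    qed
    show "univ_norm R (f * g) \<le> univ_norm R f * univ_norm R g"
    proof (rule univ_norm_least)
      fix s assume s: "cstar_seminorm s" "\<forall>r\<in>R. s r = 0"
      have "s (f * g) \<le> s f * s g" by (rule cstar_seminormD[OF s(1)])
      also have "\<dots> \<le> univ_norm R f * univ_norm R g"
        by (intro mult_mono up[OF s] cstar_seminorm_nonneg[OF s(1)] nn)
      finally show "s (f * g) \<le> univ_norm R f * univ_norm R g" .
    qed
    show "univ_norm R (free_adj f * f) = (univ_norm R f)\<^sup>2"
    proof (rule antisym)
      show "univ_norm R (free_adj f * f) \<le> (univ_norm R f)\<^sup>2"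
        by (rule univ_norm_least)
           (auto simp: cstar_seminormD intro!: power_mono up cstar_seminorm_nonneg)
      have "s f \<le> sqrt (univ_norm R (free_adj f * f))" if s: "cstar_seminorm s" "\<forall>r\<in>R. s r = 0" for s
        using up[OF s, of "free_adj f * f"] by (intro real_le_rsqrt) (simp add: cstar_seminormD[OF s(1)])
      then have "univ_norm R f \<le> sqrt (univ_norm R (free_adj f * f))"
        by (rule univ_norm_least)
      then show "(univ_norm R f)\<^sup>2 \<le> univ_norm R (free_adj f * f)"
        using nn by (metis real_sqrt_ge_0_iff real_sqrt_pow2 power_mono)
    qed
  qed
qed

section \<open>The separated completion\<close>

text \<open>The operations of \<open>univ_cstar\<close> are unions over all representatives; such a
  union is the intended class once all its members coincide.\<close>

lemma UN_constI: "A \<noteq> {} \<Longrightarrow> (\<And>x. x \<in> A \<Longrightarrow> F x = K) \<Longrightarrow> (\<Union>x\<in>A. F x) = K"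
  by auto

locale univ_completion =
  fixes R :: "'g free_star set"
  assumes seminorm: "cstar_seminorm (univ_norm R)"
begin

abbreviation (input) p :: "'g free_star \<Rightarrow> real" where "p \<equiv> univ_norm R"
abbreviation (input) cl :: "(nat \<Rightarrow> 'g free_star) \<Rightarrow> (nat \<Rightarrow> 'g free_star) set" where "cl \<equiv> univ_class R"
abbreviation (input) A :: "(nat \<Rightarrow> 'g free_star) set cstar" where "A \<equiv> univ_cstar R"

lemmas p_add = cstar_seminormD(1)[OF seminorm]
  and p_scale = cstar_seminormD(2)[OF seminorm]
  and p_mult = cstar_seminormD(3)[OF seminorm]
  and p_cstar = cstar_seminormD(4)[OF seminorm]
  and p_zero [simp] = cstar_seminorm_zero[OF seminorm]
  and p_nonneg [simp] = cstar_seminorm_nonneg[OF seminorm]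
  and p_commute = cstar_seminorm_commute[OF seminorm]
  and p_abs_diff = cstar_seminorm_abs_diff[OF seminorm]
  and p_adj [simp] = cstar_seminorm_adj[OF seminorm]

lemma p_triangle: "p (f - h) \<le> p (f - g) + p (g - h)"
  using p_add[of "f - g" "g - h"] by simp

text \<open>This splitting of a difference of products serves both the Cauchy property of products
  and their independence of representatives.\<close>

lemma p_mult_diff: "p (f * g - f' * g') \<le> p f * p (g - g') + p (f - f') * p g'"
proof -
  have "f * g - f' * g' = f * (g - g') + (f - f') * g'" by (simp add: algebra_simps)
  then have "p (f * g - f' * g') \<le> p (f * (g - g')) + p ((f - f') * g')"
    using p_add by simp
  then show ?thesis using p_mult[of f "g - g'"] p_mult[of "f - f'" g'] by linarith
qed

lemma CauchyD:
  assumes "X \<in> univ_Cauchy R" "0 < e"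
  shows "\<exists>M. \<forall>m\<ge>M. \<forall>n\<ge>M. p (X m - X n) < e"
  using assms by (auto simp: univ_Cauchy_def)

lemma CauchyI:
  assumes "\<And>e. 0 < e \<Longrightarrow> \<exists>M. \<forall>m\<ge>M. \<forall>n\<ge>M. p (X m - X n) < e"
  shows "X \<in> univ_Cauchy R"
  using assms by (auto simp: univ_Cauchy_def)

lemma Cauchy_lipschitz:
  assumes X: "X \<in> univ_Cauchy R"
    and L: "\<And>m n. p (Y m - Y n) \<le> L * p (X m - X n)"
  shows "Y \<in> univ_Cauchy R"
proof (rule CauchyI)
  fix e :: real assume e: "0 < e"
  \<comment> \<open>The constant \<open>L\<close> may be zero or negative, hence the denominator
    \<open>\<bar>L\<bar> + 1\<close>.\<close>
  have "0 < e / (\<bar>L\<bar> + 1)" using e by simp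
  then obtain M where M: "\<forall>m\<ge>M. \<forall>n\<ge>M. p (X m - X n) < e / (\<bar>L\<bar> + 1)"
    using CauchyD[OF X] by blast
  have "p (Y m - Y n) < e" if "m \<ge> M" "n \<ge> M" for m n
  proof -
    have "p (Y m - Y n) \<le> (\<bar>L\<bar> + 1) * p (X m - X n)"
      using L[of m n] by (rule order_trans) (intro mult_right_mono, auto)
    also have "\<dots> < (\<bar>L\<bar> + 1) * (e / (\<bar>L\<bar> + 1))"
      using M that by (intro mult_strict_left_mono) auto
    finally show ?thesis by simp
  qed
  then show "\<exists>M. \<forall>m\<ge>M. \<forall>n\<ge>M. p (Y m - Y n) < e" by blast
qed

lemma Cauchy_const [simp]: "(\<lambda>_. f) \<in> univ_Cauchy R"
  by (rule CauchyI) auto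

lemma Cauchy_add [simp]:
  assumes X: "X \<in> univ_Cauchy R" and Y: "Y \<in> univ_Cauchy R"
  shows "(\<lambda>n. X n + Y n) \<in> univ_Cauchy R"
proof (rule CauchyI)
  fix e :: real assume "0 < e"
  then obtain M N where
    "\<forall>m\<ge>M. \<forall>n\<ge>M. p (X m - X n) < e / 2" "\<forall>m\<ge>N. \<forall>n\<ge>N. p (Y m - Y n) < e / 2"
    using CauchyD[OF X, of "e / 2"] CauchyD[OF Y, of "e / 2"] by auto
  moreover have "p (X m + Y m - (X n + Y n)) \<le> p (X m - X n) + p (Y m - Y n)" for m n
    using p_add[of "X m - X n" "Y m - Y n"] by (simp add: algebra_simps)
  ultimately show "\<exists>M. \<forall>m\<ge>M. \<forall>n\<ge>M. p (X m + Y m - (X n + Y n)) < e"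
    by (intro exI[of _ "max M N"]) (smt (verit, best) field_sum_of_halves max.bounded_iff)
qed

lemma Cauchy_scale [simp]:
  assumes X: "X \<in> univ_Cauchy R"
  shows "(\<lambda>n. free_scale c (X n)) \<in> univ_Cauchy R"
  by (rule Cauchy_lipschitz[OF X, of _ "cmod c"]) (simp add: p_scale flip: free_scale_diff_right)

lemma Cauchy_adj [simp]:
  assumes X: "X \<in> univ_Cauchy R"
  shows "(\<lambda>n. free_adj (X n)) \<in> univ_Cauchy R"
  by (rule Cauchy_lipschitz[OF X, of _ 1]) (simp flip: free_adj_diff)

lemma Cauchy_diff [simp]:
  assumes "X \<in> univ_Cauchy R" and Y: "Y \<in> univ_Cauchy R"
  shows "(\<lambda>n. X n - Y n) \<in> univ_Cauchy R"
  using Cauchy_add[OF assms(1) Cauchy_scale[OF Y, of "-1"]] by (simp add: free_scale_minus_one)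

lemma Cauchy_norm_convergent:
  assumes X: "X \<in> univ_Cauchy R"
  shows "convergent (\<lambda>n. p (X n))"
proof -
  have "Cauchy (\<lambda>n. p (X n))"
  proof (rule metric_CauchyI)
    fix e :: real assume "0 < e"
    then obtain M where "\<forall>m\<ge>M. \<forall>n\<ge>M. p (X m - X n) < e" using CauchyD[OF X] by blast
    then show "\<exists>M. \<forall>m\<ge>M. \<forall>n\<ge>M. dist (p (X m)) (p (X n)) < e"
      using order_le_less_trans[OF p_abs_diff] by (auto simp: dist_real_def intro!: exI[of _ M])
  qed
  then show ?thesis by (simp add: Cauchy_convergent_iff)
qed

lemma Cauchy_bounded:
  assumes X: "X \<in> univ_Cauchy R"
  obtains B where "B > 0" "\<And>n. p (X n) \<le> B"
proof -
  have "Bseq (\<lambda>n. p (X n))"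
    using Cauchy_norm_convergent[OF X] by (rule convergent_imp_Bseq)
  then obtain B where "B > 0" "\<forall>n. norm (p (X n)) \<le> B" by (meson BseqE)
  then show ?thesis by (intro that[of B]) auto
qed

lemma Cauchy_mult [simp]:
  assumes X: "X \<in> univ_Cauchy R" and Y: "Y \<in> univ_Cauchy R"
  shows "(\<lambda>n. X n * Y n) \<in> univ_Cauchy R"
proof (rule CauchyI)
  fix e :: real assume e: "0 < e"
  obtain B where B: "B > 0" "\<And>n. p (X n) \<le> B" by (rule Cauchy_bounded[OF X]) blast
  obtain D where D: "D > 0" "\<And>n. p (Y n) \<le> D" by (rule Cauchy_bounded[OF Y]) blast
  obtain M where M: "\<forall>m\<ge>M. \<forall>n\<ge>M. p (X m - X n) < e / (2 * D)"
    using CauchyD[OF X, of "e / (2 * D)"] e D by auto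
  obtain N where N: "\<forall>m\<ge>N. \<forall>n\<ge>N. p (Y m - Y n) < e / (2 * B)"
    using CauchyD[OF Y, of "e / (2 * B)"] e B by auto
  have "p (X m * Y m - X n * Y n) < e" if "m \<ge> max M N" "n \<ge> max M N" for m n
  proof -
    have "p (X m) * p (Y m - Y n) \<le> B * p (Y m - Y n)"
      using B by (intro mult_right_mono) auto
    also have "\<dots> < B * (e / (2 * B))"
      using N that B by (intro mult_strict_left_mono) auto
    also have "\<dots> = e / 2" using B by simp
    finally have 1: "p (X m) * p (Y m - Y n) < e / 2" .
    have "p (X m - X n) * p (Y n) \<le> p (X m - X n) * D"
      using D by (intro mult_left_mono) auto
    also have "\<dots> < e / (2 * D) * D"
      using M that D by (intro mult_strict_right_mono) auto
    also have "\<dots> = e / 2" using D by simp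
    finally have 2: "p (X m - X n) * p (Y n) < e / 2" .
    show ?thesis using 1 2 p_mult_diff[of "X m" "Y m" "X n" "Y n"] by linarith
  qed
  then show "\<exists>M. \<forall>m\<ge>M. \<forall>n\<ge>M. p (X m * Y m - X n * Y n) < e" by blast
qed

section \<open>Classes of Cauchy sequences and the operations on them\<close>

lemma mem_class_iff: "Y \<in> cl X \<longleftrightarrow> Y \<in> univ_Cauchy R \<and> (\<lambda>n. p (X n - Y n)) \<longlonglongrightarrow> 0"
  by (simp add: univ_class_def)

lemma class_self: "X \<in> univ_Cauchy R \<Longrightarrow> X \<in> cl X"
  by (simp add: mem_class_iff)

lemma null_mono:
  assumes "(\<lambda>n. a n) \<longlonglongrightarrow> (0::real)" "\<And>n. p (X n) \<le> a n"
  shows "(\<lambda>n. p (X n)) \<longlonglongrightarrow> 0"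
  by (rule tendsto_sandwich[OF _ _ tendsto_const assms(1)]) (auto simp: assms(2))

lemma class_eqI:
  assumes lim: "(\<lambda>n. p (X n - Y n)) \<longlonglongrightarrow> 0"
  shows "cl X = cl Y"
proof -
  have "(\<lambda>n. p (X n - Z n)) \<longlonglongrightarrow> 0 \<longleftrightarrow> (\<lambda>n. p (Y n - Z n)) \<longlonglongrightarrow> 0" for Z
  proof
    assume XZ: "(\<lambda>n. p (X n - Z n)) \<longlonglongrightarrow> 0"
    have "p (Y n - Z n) \<le> p (X n - Y n) + p (X n - Z n)" for n
      using p_triangle[of "Y n" "Z n" "X n"] p_commute[of "X n" "Y n"] by simp
    then show "(\<lambda>n. p (Y n - Z n)) \<longlonglongrightarrow> 0"
      by (rule null_mono[OF tendsto_add_zero[OF lim XZ]])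
  next
    assume YZ: "(\<lambda>n. p (Y n - Z n)) \<longlonglongrightarrow> 0"
    show "(\<lambda>n. p (X n - Z n)) \<longlonglongrightarrow> 0"
      by (rule null_mono[OF tendsto_add_zero[OF lim YZ] p_triangle])
  qed
  then show ?thesis by (auto simp: univ_class_def)
qed

lemma carrier_eq: "carrier A = cl ` univ_Cauchy R"
  by (simp add: univ_cstar_def)

lemma class_closed [simp]: "X \<in> univ_Cauchy R \<Longrightarrow> cl X \<in> carrier A"
  by (simp add: carrier_eq)

lemma carrierE:
  assumes "a \<in> carrier A"
  obtains X where "X \<in> univ_Cauchy R" "a = cl X"
  using assms by (auto simp: carrier_eq)

lemma one_eq: "\<one>\<^bsub>A\<^esub> = cl (\<lambda>_. 1)" and zero_eq: "\<zero>\<^bsub>A\<^esub> = cl (\<lambda>_. 0)"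
  by (simp_all add: univ_cstar_def)

text \<open>Well-definedness: if \<open>F\<close> respects null differences from the chosen
  representative \<open>X\<close>, the union over the class collapses to the value computed from
  \<open>X\<close>.\<close>

lemma class_ext:
  assumes X: "X \<in> univ_Cauchy R"
    and F: "\<And>Y. Y \<in> univ_Cauchy R \<Longrightarrow> (\<lambda>n. p (X n - Y n)) \<longlonglongrightarrow> 0 \<Longrightarrow>
      (\<lambda>n. p (F (X n) - F (Y n))) \<longlonglongrightarrow> 0"
  shows "(\<Union>Y\<in>cl X. cl (\<lambda>n. F (Y n))) = cl (\<lambda>n. F (X n))"
proof (rule UN_constI)
  fix Y assume "Y \<in> cl X"
  then show "cl (\<lambda>n. F (Y n)) = cl (\<lambda>n. F (X n))"
    using F[of Y] by (intro class_eqI) (simp add: mem_class_iff p_commute)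
qed (use class_self[OF X] in blast)

lemma class_ext2:
  assumes X: "X \<in> univ_Cauchy R" and Y: "Y \<in> univ_Cauchy R"
    and F: "\<And>X' Y'. X' \<in> univ_Cauchy R \<Longrightarrow> Y' \<in> univ_Cauchy R \<Longrightarrow>
      (\<lambda>n. p (X n - X' n)) \<longlonglongrightarrow> 0 \<Longrightarrow> (\<lambda>n. p (Y n - Y' n)) \<longlonglongrightarrow> 0 \<Longrightarrow>
      (\<lambda>n. p (F (X n) (Y n) - F (X' n) (Y' n))) \<longlonglongrightarrow> 0"
  shows "(\<Union>X'\<in>cl X. \<Union>Y'\<in>cl Y. cl (\<lambda>n. F (X' n) (Y' n))) = cl (\<lambda>n. F (X n) (Y n))"
proof (intro UN_constI)
  fix X' Y' assume "X' \<in> cl X" "Y' \<in> cl Y"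
  then show "cl (\<lambda>n. F (X' n) (Y' n)) = cl (\<lambda>n. F (X n) (Y n))"
    using F[of X' Y'] by (intro class_eqI) (simp add: mem_class_iff p_commute)
qed (use class_self X Y in blast)+

lemma add_class:
  assumes "X \<in> univ_Cauchy R" "Y \<in> univ_Cauchy R"
  shows "cl X \<oplus>\<^bsub>A\<^esub> cl Y = cl (\<lambda>n. X n + Y n)"
proof -
  have "(\<lambda>n. p (X n + Y n - (X' n + Y' n))) \<longlonglongrightarrow> 0"
    if "(\<lambda>n. p (X n - X' n)) \<longlonglongrightarrow> 0" "(\<lambda>n. p (Y n - Y' n)) \<longlonglongrightarrow> 0" for X' Y'
  proof (rule null_mono[OF tendsto_add_zero[OF that]])
    show "p (X n + Y n - (X' n + Y' n)) \<le> p (X n - X' n) + p (Y n - Y' n)" for n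
      using p_add[of "X n - X' n" "Y n - Y' n"] by (simp add: algebra_simps)
  qed
  then show ?thesis
    using class_ext2[OF assms, of "(+)"] by (simp add: univ_cstar_def)
qed

lemma mult_class:
  assumes X: "X \<in> univ_Cauchy R" and Y: "Y \<in> univ_Cauchy R"
  shows "cl X \<otimes>\<^bsub>A\<^esub> cl Y = cl (\<lambda>n. X n * Y n)"
proof -
  have "(\<lambda>n. p (X n * Y n - X' n * Y' n)) \<longlonglongrightarrow> 0"
    if lim: "(\<lambda>n. p (X n - X' n)) \<longlonglongrightarrow> 0" "(\<lambda>n. p (Y n - Y' n)) \<longlonglongrightarrow> 0"
      and Y': "Y' \<in> univ_Cauchy R" for X' Y'
  proof -
    \<comment> \<open>In the estimate for products each null factor stands next to the norm of a
      Cauchy sequence, and these norms converge.\<close>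
    obtain a b where "(\<lambda>n. p (X n)) \<longlonglongrightarrow> a" "(\<lambda>n. p (Y' n)) \<longlonglongrightarrow> b"
      using Cauchy_norm_convergent[OF X] Cauchy_norm_convergent[OF Y'] by (auto simp: convergent_def)
    then have "(\<lambda>n. p (X n) * p (Y n - Y' n) + p (X n - X' n) * p (Y' n)) \<longlonglongrightarrow> a * 0 + 0 * b"
      using lim by (intro tendsto_intros)
    then show ?thesis
      by (intro null_mono[OF _ p_mult_diff]) simp
  qed
  then show ?thesis
    using class_ext2[OF assms, of "(*)"] by (simp add: univ_cstar_def)
qed

lemma smult_class:
  assumes X: "X \<in> univ_Cauchy R"
  shows "c \<odot>\<^bsub>A\<^esub> cl X = cl (\<lambda>n. free_scale c (X n))"
  using class_ext[OF X, of "free_scale c"]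
  by (simp add: univ_cstar_def p_scale tendsto_mult_right_zero flip: free_scale_diff_right)

lemma adj_class:
  assumes X: "X \<in> univ_Cauchy R"
  shows "adj A (cl X) = cl (\<lambda>n. free_adj (X n))"
  using class_ext[OF X, of free_adj] by (simp add: univ_cstar_def flip: free_adj_diff)

text \<open>The definite description in \<open>cnorm\<close> denotes a number because norms of
  equivalent sequences differ by a null sequence and limits are unique. Uniqueness needs a member of
  the class, which is \<open>X\<close> itself.\<close>

lemma cnorm_class_eq:
  assumes X: "X \<in> univ_Cauchy R" and l: "(\<lambda>n. p (X n)) \<longlonglongrightarrow> l"
  shows "cnorm A (cl X) = l"
proof -
  have "(\<lambda>n. p (Y n)) \<longlonglongrightarrow> l" if "Y \<in> cl X" for Y
  proof -
    have null: "(\<lambda>n. p (X n - Y n)) \<longlonglongrightarrow> 0" using that by (simp add: mem_class_iff)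
    have "norm (p (Y n) - p (X n)) \<le> p (X n - Y n)" for n
      using p_abs_diff[of "X n" "Y n"] by (simp add: abs_minus_commute)
    then have "(\<lambda>n. p (Y n) - p (X n)) \<longlonglongrightarrow> 0"
      by (intro Lim_null_comparison[OF always_eventually null] allI)
    from tendsto_add[OF this l] show ?thesis by simp
  qed
  then have "(THE l. \<forall>Y\<in>cl X. (\<lambda>n. p (Y n)) \<longlonglongrightarrow> l) = l"
    using class_self[OF X] l by (intro the_equality) (auto intro: LIMSEQ_unique)
  then show ?thesis by (simp add: univ_cstar_def)
qed

lemma cnorm_class:
  assumes X: "X \<in> univ_Cauchy R"
  shows "(\<lambda>n. p (X n)) \<longlonglongrightarrow> cnorm A (cl X)"
  using Cauchy_norm_convergent[OF X] cnorm_class_eq[OF X] by (auto simp: convergent_def)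

lemma cnorm_const: "cnorm A (cl (\<lambda>_. f)) = p f"
  by (rule cnorm_class_eq) auto

lemmas class_simps = add_class mult_class smult_class adj_class one_eq zero_eq

lemma cring_complex_scalars: "cring complex_scalars"
proof -
  have "\<exists>y. x + y = 0" for x :: complex by (rule exI[of _ "- x"]) simp
  then show ?thesis
    by (auto intro!: cringI abelian_groupI comm_monoidI simp: complex_scalars_def algebra_simps)
qed

lemma abelian_group_univ: "abelian_group A"
proof (rule abelian_groupI; (elim carrierE)?)
  fix a X assume "X \<in> univ_Cauchy R" "a = cl X"
  then show "\<exists>b\<in>carrier A. b \<oplus>\<^bsub>A\<^esub> a = \<zero>\<^bsub>A\<^esub>"
    using Cauchy_diff[of "\<lambda>_. 0" X] by (intro bexI[of _ "cl (\<lambda>n. 0 - X n)"]) (simp_all add: class_simps)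
qed (simp_all add: class_simps algebra_simps)

lemma ring_univ: "ring A"
  by (rule ringI[OF abelian_group_univ]; (rule monoidI)?; (elim carrierE)?) (simp_all add: class_simps algebra_simps)

lemma module_univ: "Module.module complex_scalars A"
  by (rule moduleI[OF cring_complex_scalars abelian_group_univ]; (elim carrierE)?)
     (simp_all add: class_simps complex_scalars_def free_scale_add_left free_scale_add_right free_scale_scale)

lemma minus_class:
  assumes X: "X \<in> univ_Cauchy R" and Y: "Y \<in> univ_Cauchy R"
  shows "cl X \<ominus>\<^bsub>A\<^esub> cl Y = cl (\<lambda>n. X n - Y n)"
proof -
  interpret abelian_group A by (rule abelian_group_univ)
  have "\<ominus>\<^bsub>A\<^esub> cl Y = cl (\<lambda>n. 0 - Y n)"
    using Cauchy_diff[OF Cauchy_const[of 0] Y] Y by (intro minus_equality) (simp_all add: class_simps)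
  then show ?thesis
    using Cauchy_diff[OF Cauchy_const[of 0] Y] X by (simp add: a_minus_def class_simps)
qed

lemma dist_triangle:
  assumes "a \<in> carrier A" "b \<in> carrier A" "c \<in> carrier A"
  shows "cnorm A (a \<ominus>\<^bsub>A\<^esub> c) \<le> cnorm A (a \<ominus>\<^bsub>A\<^esub> b) + cnorm A (b \<ominus>\<^bsub>A\<^esub> c)"
  using assms
proof (elim carrierE)
  fix X Y Z assume C: "X \<in> univ_Cauchy R" "Y \<in> univ_Cauchy R" "Z \<in> univ_Cauchy R"
    and eq: "a = cl X" "b = cl Y" "c = cl Z"
  have "cnorm A (cl (\<lambda>n. X n - Z n)) \<le> cnorm A (cl (\<lambda>n. X n - Y n)) + cnorm A (cl (\<lambda>n. Y n - Z n))"
    using C p_triangle by (intro LIMSEQ_le[OF cnorm_class tendsto_add[OF cnorm_class cnorm_class]]) auto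
  then show ?thesis using C by (simp add: eq minus_class)
qed

lemma dist_commute:
  assumes "a \<in> carrier A" "b \<in> carrier A"
  shows "cnorm A (a \<ominus>\<^bsub>A\<^esub> b) = cnorm A (b \<ominus>\<^bsub>A\<^esub> a)"
  using assms
proof (elim carrierE)
  fix X Y assume C: "X \<in> univ_Cauchy R" "Y \<in> univ_Cauchy R" and eq: "a = cl X" "b = cl Y"
  have "(\<lambda>n. p (Y n - X n)) \<longlonglongrightarrow> cnorm A (cl (\<lambda>n. X n - Y n))"
    using cnorm_class[OF Cauchy_diff[OF C]] by (simp add: p_commute)
  then have "cnorm A (cl (\<lambda>n. Y n - X n)) = cnorm A (cl (\<lambda>n. X n - Y n))"
    using C by (intro cnorm_class_eq) auto
  then show ?thesis using C by (simp add: eq minus_class)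
qed

section \<open>Density of the free algebra and completeness\<close>

lemma dense_tail:
  assumes X: "X \<in> univ_Cauchy R" and N: "\<forall>n\<ge>N. p (X n - f) < e"
  shows "cnorm A (cl X \<ominus>\<^bsub>A\<^esub> cl (\<lambda>_. f)) \<le> e"
proof -
  have "(\<lambda>n. p (X n - f)) \<longlonglongrightarrow> cnorm A (cl (\<lambda>n. X n - f))"
    using X by (intro cnorm_class) simp
  then have "cnorm A (cl (\<lambda>n. X n - f)) \<le> e"
    using N by (intro LIMSEQ_le_const2) (auto intro: less_imp_le)
  then show ?thesis using X by (simp add: minus_class)
qed

lemma dense:
  assumes "a \<in> carrier A" "0 < e"
  obtains f where "cnorm A (a \<ominus>\<^bsub>A\<^esub> cl (\<lambda>_. f)) < e"
proof -
  obtain X where X: "X \<in> univ_Cauchy R" "a = cl X" using assms(1) by (rule carrierE)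
  obtain M where "\<forall>m\<ge>M. \<forall>n\<ge>M. p (X m - X n) < e / 2" using CauchyD[OF X(1), of "e / 2"] assms by auto
  \<comment> \<open>Passing to the limit weakens a strict bound to \<open>\<le>\<close>, so the tail
    was chosen with half the tolerance.\<close>
  then have "cnorm A (a \<ominus>\<^bsub>A\<^esub> cl (\<lambda>_. X M)) \<le> e / 2"
    unfolding X(2) by (intro dense_tail[OF X(1), of M]) auto
  then show ?thesis using assms(2) by (intro that[of "X M"]) linarith
qed

text \<open>A diagonal argument: the \<open>n\<close>-th class is approximated within
  \<open>1 / Suc n\<close> by the class of a constant sequence with value \<open>Z n\<close>. The
  sequence \<open>Z\<close> is then Cauchy in the free algebra, and its class is the limit.\<close>

lemma complete:
  assumes X: "\<forall>n::nat. X n \<in> carrier A"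
    and Cau: "\<forall>e>0. \<exists>M. \<forall>m\<ge>M. \<forall>n\<ge>M. cnorm A (X m \<ominus>\<^bsub>A\<^esub> X n) < e"
  shows "\<exists>x\<in>carrier A. (\<lambda>n. cnorm A (X n \<ominus>\<^bsub>A\<^esub> x)) \<longlonglongrightarrow> 0"
proof -
  have "\<exists>f. cnorm A (X n \<ominus>\<^bsub>A\<^esub> cl (\<lambda>_. f)) < 1 / Suc n" for n
    using dense[of "X n" "1 / Suc n"] X by auto
  then obtain Z where Z: "\<And>n. cnorm A (X n \<ominus>\<^bsub>A\<^esub> cl (\<lambda>_. Z n)) < 1 / Suc n" by metis
  have Z0: "(\<lambda>n. 1 / real (Suc n)) \<longlonglongrightarrow> 0" using LIMSEQ_inverse_real_of_nat by (simp add: inverse_eq_divide)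
  have ev: "\<exists>M. \<forall>n\<ge>M. 1 / real (Suc n) < e" if "e > 0" for e
    using order_tendstoD(2)[OF Z0 that] by (simp add: eventually_sequentially)
  have ZC: "Z \<in> univ_Cauchy R"
  proof (rule CauchyI)
    fix e :: real assume e: "0 < e"
    obtain M where M: "\<forall>m\<ge>M. \<forall>n\<ge>M. cnorm A (X m \<ominus>\<^bsub>A\<^esub> X n) < e / 3" using Cau e by (metis divide_pos_pos zero_less_numeral)
    obtain N where N: "\<forall>n\<ge>N. 1 / real (Suc n) < e / 3" using ev[of "e / 3"] e by auto
    have "p (Z m - Z n) < e" if mn: "m \<ge> max M N" "n \<ge> max M N" for m n
    proof -
      \<comment> \<open>On constant sequences the norm of the completion is the original seminorm,
        so an estimate between classes becomes one between the elements \<open>Z m\<close> and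
        \<open>Z n\<close>.\<close>
      have "p (Z m - Z n) = cnorm A (cl (\<lambda>_. Z m) \<ominus>\<^bsub>A\<^esub> cl (\<lambda>_. Z n))"
        by (simp add: minus_class cnorm_const)
      also have "\<dots> \<le> cnorm A (cl (\<lambda>_. Z m) \<ominus>\<^bsub>A\<^esub> X m) + cnorm A (X m \<ominus>\<^bsub>A\<^esub> cl (\<lambda>_. Z n))"
        using X by (intro dist_triangle) auto
      also have "cnorm A (X m \<ominus>\<^bsub>A\<^esub> cl (\<lambda>_. Z n)) \<le> cnorm A (X m \<ominus>\<^bsub>A\<^esub> X n) + cnorm A (X n \<ominus>\<^bsub>A\<^esub> cl (\<lambda>_. Z n))"
        using X by (intro dist_triangle) auto
      also have "cnorm A (cl (\<lambda>_. Z m) \<ominus>\<^bsub>A\<^esub> X m) = cnorm A (X m \<ominus>\<^bsub>A\<^esub> cl (\<lambda>_. Z m))"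
        using X by (intro dist_commute) auto
      finally have "p (Z m - Z n) \<le> cnorm A (X m \<ominus>\<^bsub>A\<^esub> cl (\<lambda>_. Z m)) +
          (cnorm A (X m \<ominus>\<^bsub>A\<^esub> X n) + cnorm A (X n \<ominus>\<^bsub>A\<^esub> cl (\<lambda>_. Z n)))" by simp
      moreover have "cnorm A (X m \<ominus>\<^bsub>A\<^esub> X n) < e / 3" using M mn by auto
      moreover have "cnorm A (X m \<ominus>\<^bsub>A\<^esub> cl (\<lambda>_. Z m)) < e / 3" "cnorm A (X n \<ominus>\<^bsub>A\<^esub> cl (\<lambda>_. Z n)) < e / 3"
        using Z[of m] Z[of n] N mn by (meson max.bounded_iff order_less_trans)+
      ultimately show ?thesis by linarith
    qed
    then show "\<exists>M. \<forall>m\<ge>M. \<forall>n\<ge>M. p (Z m - Z n) < e" by blast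
  qed
  have "(\<lambda>n. cnorm A (X n \<ominus>\<^bsub>A\<^esub> cl Z)) \<longlonglongrightarrow> 0"
  proof (rule LIMSEQ_I)
    fix e :: real assume e: "0 < e"
    obtain M where M: "\<forall>m\<ge>M. \<forall>n\<ge>M. p (Z m - Z n) < e / 2" using CauchyD[OF ZC, of "e / 2"] e by auto
    obtain N where N: "\<forall>n\<ge>N. 1 / real (Suc n) < e / 2" using ev[of "e / 2"] e by auto
    have "norm (cnorm A (X n \<ominus>\<^bsub>A\<^esub> cl Z) - 0) < e" if n: "n \<ge> max M N" for n
    proof -
      have "cnorm A (cl Z \<ominus>\<^bsub>A\<^esub> cl (\<lambda>_. Z n)) \<le> e / 2"
        using M n by (intro dense_tail[OF ZC, of M]) auto
      then have 1: "cnorm A (cl (\<lambda>_. Z n) \<ominus>\<^bsub>A\<^esub> cl Z) \<le> e / 2"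
        using dist_commute[of "cl Z" "cl (\<lambda>_. Z n)"] ZC by simp
      have 2: "cnorm A (X n \<ominus>\<^bsub>A\<^esub> cl (\<lambda>_. Z n)) < e / 2" using Z[of n] N n by fastforce
      have 3: "cnorm A (X n \<ominus>\<^bsub>A\<^esub> cl Z) \<le> cnorm A (X n \<ominus>\<^bsub>A\<^esub> cl (\<lambda>_. Z n)) + cnorm A (cl (\<lambda>_. Z n) \<ominus>\<^bsub>A\<^esub> cl Z)"
        using X ZC by (intro dist_triangle) auto
      obtain Y where "Y \<in> univ_Cauchy R" "X n = cl Y" using X carrierE by metis
      then have "0 \<le> cnorm A (X n \<ominus>\<^bsub>A\<^esub> cl Z)"
        using ZC by (auto simp: minus_class intro!: LIMSEQ_le_const[OF cnorm_class])
      then show ?thesis using 1 2 3 by simp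
    qed
    then show "\<exists>N. \<forall>n\<ge>N. norm (cnorm A (X n \<ominus>\<^bsub>A\<^esub> cl Z) - 0) < e" by blast
  qed
  then show ?thesis using ZC by (intro bexI[of _ "cl Z"]) auto
qed

lemma cnorm_nonneg: "X \<in> univ_Cauchy R \<Longrightarrow> 0 \<le> cnorm A (cl X)"
  by (rule LIMSEQ_le_const[OF cnorm_class]) auto

lemma cnorm_eq_0_iff:
  assumes X: "X \<in> univ_Cauchy R"
  shows "cnorm A (cl X) = 0 \<longleftrightarrow> cl X = \<zero>\<^bsub>A\<^esub>"
proof
  assume "cnorm A (cl X) = 0"
  then show "cl X = \<zero>\<^bsub>A\<^esub>" using cnorm_class[OF X] unfolding zero_eq by (intro class_eqI) simp
next
  assume "cl X = \<zero>\<^bsub>A\<^esub>"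
  then show "cnorm A (cl X) = 0" by (simp add: zero_eq cnorm_const)
qed

lemma cnorm_smult:
  assumes X: "X \<in> univ_Cauchy R"
  shows "cnorm A (cl (\<lambda>n. free_scale c (X n))) = cmod c * cnorm A (cl X)"
  using X by (intro cnorm_class_eq) (auto simp: p_scale intro!: tendsto_intros cnorm_class)

lemma cnorm_add:
  assumes X: "X \<in> univ_Cauchy R" and Y: "Y \<in> univ_Cauchy R"
  shows "cnorm A (cl (\<lambda>n. X n + Y n)) \<le> cnorm A (cl X) + cnorm A (cl Y)"
  using assms p_add by (intro LIMSEQ_le[OF cnorm_class tendsto_add[OF cnorm_class cnorm_class]]) auto

lemma cnorm_mult:
  assumes X: "X \<in> univ_Cauchy R" and Y: "Y \<in> univ_Cauchy R"
  shows "cnorm A (cl (\<lambda>n. X n * Y n)) \<le> cnorm A (cl X) * cnorm A (cl Y)"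
  using assms p_mult by (intro LIMSEQ_le[OF cnorm_class tendsto_mult[OF cnorm_class cnorm_class]]) auto

lemma cnorm_cstar:
  assumes X: "X \<in> univ_Cauchy R"
  shows "cnorm A (cl (\<lambda>n. free_adj (X n) * X n)) = (cnorm A (cl X))\<^sup>2"
  using X by (intro cnorm_class_eq) (auto simp: p_cstar intro!: tendsto_intros cnorm_class)

text \<open>Apart from completeness, the axioms reduce after the choice of representatives to
  identities in the free *-algebra and to limits of relations between seminorm values.\<close>

theorem cstar_algebra_univ: "cstar_algebra A"
  unfolding cstar_algebra_def
  by (intro conjI ballI allI ring_univ module_univ; (intro impI complete, simp, simp)?; (elim carrierE)?)
     (simp_all add: class_simps free_adj_add free_adj_mult free_adj_scale free_scale_mult_left
       free_scale_mult_right cnorm_nonneg cnorm_eq_0_iff[unfolded zero_eq] cnorm_smult cnorm_add cnorm_mult cnorm_cstar)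

end

section \<open>Continuous functions with values in a C*-algebra\<close>

locale cstar =
  fixes A :: "('a, 'm) cstar_scheme" (structure)
  assumes cstar: "cstar_algebra A"
begin

sublocale ring A
  using cstar by (simp add: cstar_algebra_def)

text \<open>The module laws refer to the operations of the record \<open>complex_scalars\<close>;
  here they are put in terms of the arithmetic of complex numbers.\<close>

lemma
  assumes "x \<in> carrier A"
  shows smult_closed [simp, intro]: "c \<odot> x \<in> carrier A"
    and smult_add_left: "(c + d) \<odot> x = c \<odot> x \<oplus> d \<odot> x"
    and smult_smult: "c \<odot> (d \<odot> x) = (c * d) \<odot> x"
    and smult_one [simp]: "1 \<odot> x = x"
    and cnorm_nonneg [simp]: "0 \<le> cnorm A x"
    and cnorm_eq_0_iff: "cnorm A x = 0 \<longleftrightarrow> x = \<zero>"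
    and cnorm_smult: "cnorm A (c \<odot> x) = cmod c * cnorm A x"
    and adj_closed [simp, intro]: "adj A x \<in> carrier A"
proof -
  interpret M: Module.module complex_scalars A
    using cstar by (simp add: cstar_algebra_def)
  show "c \<odot> x \<in> carrier A" using M.smult_closed[of c x] assms by (simp add: complex_scalars_def)
  show "(c + d) \<odot> x = c \<odot> x \<oplus> d \<odot> x"
    using M.smult_l_distr[of c d x] assms by (simp add: complex_scalars_def)
  show "c \<odot> (d \<odot> x) = (c * d) \<odot> x"
    using M.smult_assoc1[of c d x] assms by (simp add: complex_scalars_def)
  show "1 \<odot> x = x" using M.smult_one[of x] assms by (simp add: complex_scalars_def)
qed (use cstar assms in \<open>auto simp: cstar_algebra_def\<close>)

lemma
  assumes "x \<in> carrier A" "y \<in> carrier A"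
  shows smult_add_right: "c \<odot> (x \<oplus> y) = c \<odot> x \<oplus> c \<odot> y"
    and smult_mult_left: "(c \<odot> x) \<otimes> y = c \<odot> (x \<otimes> y)"
    and smult_mult_right: "x \<otimes> (c \<odot> y) = c \<odot> (x \<otimes> y)"
    and cnorm_add: "cnorm A (x \<oplus> y) \<le> cnorm A x + cnorm A y"
    and cnorm_mult: "cnorm A (x \<otimes> y) \<le> cnorm A x * cnorm A y"
proof -
  interpret M: Module.module complex_scalars A
    using cstar by (simp add: cstar_algebra_def)
  show "c \<odot> (x \<oplus> y) = c \<odot> x \<oplus> c \<odot> y"
    using M.smult_r_distr[of c x y] assms by (simp add: complex_scalars_def)
qed (use cstar assms in \<open>auto simp: cstar_algebra_def\<close>)

lemma cnorm_zero [simp]: "cnorm A \<zero> = 0"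
  by (simp add: cnorm_eq_0_iff)

lemma smult_zero_left [simp]: "x \<in> carrier A \<Longrightarrow> 0 \<odot> x = \<zero>"
  using smult_add_left[of x 0 0] by (metis add.r_cancel_one' add_0_right smult_closed)

lemma smult_zero_right [simp]: "c \<odot> \<zero> = \<zero>"
  using smult_add_right[of \<zero> \<zero> c] by (metis add.r_cancel_one' add.one_closed smult_closed r_zero)

lemma minus_eq_smult: "x \<in> carrier A \<Longrightarrow> \<ominus> x = (-1) \<odot> x"
  using smult_add_left[of x "-1" 1] by (intro minus_equality) auto

lemma cnorm_a_inv [simp]: "x \<in> carrier A \<Longrightarrow> cnorm A (\<ominus> x) = cnorm A x"
  by (simp add: minus_eq_smult cnorm_smult)

lemma smult_diff: "x \<in> carrier A \<Longrightarrow> y \<in> carrier A \<Longrightarrow> c \<odot> (x \<ominus> y) = c \<odot> x \<ominus> c \<odot> y"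
  by (simp add: a_minus_def smult_add_right minus_eq_smult smult_smult)

lemma smult_diff_left: "x \<in> carrier A \<Longrightarrow> (c - d) \<odot> x = c \<odot> x \<ominus> d \<odot> x"
  using smult_add_left[of x c "- d"] by (simp add: a_minus_def minus_eq_smult smult_smult)

lemma mult_diff_right:
  "a \<in> carrier A \<Longrightarrow> x \<in> carrier A \<Longrightarrow> y \<in> carrier A \<Longrightarrow> a \<otimes> (x \<ominus> y) = a \<otimes> x \<ominus> a \<otimes> y"
  by (simp add: a_minus_def r_distr r_minus)

lemma add_diff_add:
  assumes "x \<in> carrier A" "y \<in> carrier A" "x' \<in> carrier A" "y' \<in> carrier A"
  shows "(x \<oplus> y) \<ominus> (x' \<oplus> y') = (x \<ominus> x') \<oplus> (y \<ominus> y')"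
  using assms by (simp add: a_minus_def minus_add a_ac)

lemma cnorm_diff_commute: "x \<in> carrier A \<Longrightarrow> y \<in> carrier A \<Longrightarrow> cnorm A (x \<ominus> y) = cnorm A (y \<ominus> x)"
  using cnorm_a_inv[of "x \<ominus> y"] by (simp add: a_minus_def minus_add a_ac)

lemma cnorm_triangle:
  assumes "x \<in> carrier A" "y \<in> carrier A" "z \<in> carrier A"
  shows "cnorm A (x \<ominus> z) \<le> cnorm A (x \<ominus> y) + cnorm A (y \<ominus> z)"
proof -
  have "(x \<ominus> y) \<oplus> (y \<ominus> z) = x \<ominus> z"
    using assms by (simp add: a_minus_def a_assoc r_neg1)
  then show ?thesis using cnorm_add[of "x \<ominus> y" "y \<ominus> z"] assms by simp
qed

lemma cnorm_le_diff:
  assumes "x \<in> carrier A" "y \<in> carrier A"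
  shows "cnorm A x \<le> cnorm A (x \<ominus> y) + cnorm A y"
  using cnorm_triangle[of x y \<zero>] assms by (simp add: a_minus_def)

lemma cnorm_diff_add:
  assumes "x \<in> carrier A" "y \<in> carrier A" "x' \<in> carrier A" "y' \<in> carrier A"
  shows "cnorm A ((x \<oplus> y) \<ominus> (x' \<oplus> y')) \<le> cnorm A (x \<ominus> x') + cnorm A (y \<ominus> y')"
  using assms by (simp add: add_diff_add cnorm_add)

lemma cnorm_diff_smult:
  "x \<in> carrier A \<Longrightarrow> y \<in> carrier A \<Longrightarrow> cnorm A (c \<odot> x \<ominus> c \<odot> y) = cmod c * cnorm A (x \<ominus> y)"
  by (simp add: cnorm_smult flip: smult_diff)

end

text \<open>Subtraction in \<open>D\<close> is defined through an inverse in the additive monoid, a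
  definite description over \<open>carrier D\<close>. Here \<open>D\<close> is just a record and not
  known to be a ring, so the inverse is identified by hand: existence is the premise
  \<open>neg\<close>, and uniqueness follows pointwise in \<open>A\<close>. This covers the bounded
  functions and the tensor product alike.\<close>

lemma a_minus_pointwise:
  fixes D :: "('x \<Rightarrow> 'a, 'n) ring_scheme" (structure)
  assumes A: "ring A"
    and add: "add D = (\<lambda>F G. \<lambda>x\<in>X. F x \<oplus>\<^bsub>A\<^esub> G x)"
    and zero: "zero D = (\<lambda>x\<in>X. \<zero>\<^bsub>A\<^esub>)"
    and sub: "carrier D \<subseteq> X \<rightarrow>\<^sub>E carrier A"
    and G: "G \<in> X \<rightarrow>\<^sub>E carrier A" and neg: "(\<lambda>x\<in>X. \<ominus>\<^bsub>A\<^esub> G x) \<in> carrier D"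
  shows "F \<ominus>\<^bsub>D\<^esub> G = (\<lambda>x\<in>X. F x \<ominus>\<^bsub>A\<^esub> G x)"
proof -
  interpret ring A by fact
  have G': "G x \<in> carrier A" if "x \<in> X" for x using G that by auto
  have "\<ominus>\<^bsub>D\<^esub> G = (\<lambda>x\<in>X. \<ominus>\<^bsub>A\<^esub> G x)"
    unfolding a_inv_def[of D] m_inv_def[of "add_monoid D"]
  proof (rule the_equality)
    fix H assume H: "H \<in> carrier (add_monoid D) \<and> G \<otimes>\<^bsub>add_monoid D\<^esub> H = \<one>\<^bsub>add_monoid D\<^esub> \<and>
        H \<otimes>\<^bsub>add_monoid D\<^esub> G = \<one>\<^bsub>add_monoid D\<^esub>"
    then have HD: "H \<in> X \<rightarrow>\<^sub>E carrier A" using sub by auto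
    show "H = (\<lambda>x\<in>X. \<ominus>\<^bsub>A\<^esub> G x)"
    proof (rule PiE_ext[OF HD])
      show "(\<lambda>x\<in>X. \<ominus>\<^bsub>A\<^esub> G x) \<in> X \<rightarrow>\<^sub>E carrier A" using G' by auto
      fix x assume x: "x \<in> X"
      have "(\<lambda>x\<in>X. H x \<oplus>\<^bsub>A\<^esub> G x) x = (\<lambda>x\<in>X. \<zero>\<^bsub>A\<^esub>) x"
        using H by (simp add: add zero)
      then have "H x \<oplus>\<^bsub>A\<^esub> G x = \<zero>\<^bsub>A\<^esub>" using x by simp
      then show "H x = (\<lambda>x\<in>X. \<ominus>\<^bsub>A\<^esub> G x) x"
        using x G'[OF x] PiE_mem[OF HD x] minus_equality[of "H x" "G x"] by simp
    qed
  qed (use neg G' in \<open>auto simp: add zero fun_eq_iff l_neg r_neg\<close>)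
  then show ?thesis by (auto simp: a_minus_def add fun_eq_iff)
qed

locale cstar_functions = cstar A for A :: "('a, 'm) cstar_scheme" (structure) +
  fixes X :: "'x :: metric_space set"
  assumes compact: "compact X" and nonempty: "X \<noteq> {}"
begin

abbreviation (input) B where "B \<equiv> bounded_functions A X"
abbreviation (input) T where "T \<equiv> tensor_C A X"

section \<open>Operations and linear spans in the function algebras\<close>

lemma tensor_ops [simp]:
  "mult T = mult B" "one T = one B" "zero T = zero B" "add T = add B" "smult T = smult B"
  "adj T = adj B" "cnorm T = cnorm B"
  by (simp_all add: tensor_C_def)

lemma bounded_ops:
  "mult B = (\<lambda>F G. \<lambda>x\<in>X. F x \<otimes> G x)" "one B = (\<lambda>x\<in>X. \<one>)" "zero B = (\<lambda>x\<in>X. \<zero>)"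
  "add B = (\<lambda>F G. \<lambda>x\<in>X. F x \<oplus> G x)" "smult B = (\<lambda>c F. \<lambda>x\<in>X. c \<odot> F x)"
  "adj B = (\<lambda>F. \<lambda>x\<in>X. adj A (F x))"
  by (simp_all add: bounded_functions_def)

text \<open>Spans involve only zero, addition and scaling, which the two algebras share; all spans
  can therefore be computed among the bounded functions.\<close>

lemma lin_span_tensor: "lin_span T S = lin_span B S"
proof (intro equalityI subsetI)
  show "F \<in> lin_span B S" if "F \<in> lin_span T S" for F
    using that
  proof (induction rule: lin_span.induct)
    case lin_span_zero
    then show ?case using lin_span.lin_span_zero[of B S] by simp
  next
    case (lin_span_step s v c)
    then show ?case using lin_span.lin_span_step[of s S v B c] by simp
  qed
  show "F \<in> lin_span T S" if "F \<in> lin_span B S" for F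
    using that
  proof (induction rule: lin_span.induct)
    case lin_span_zero
    then show ?case using lin_span.lin_span_zero[of T S] by simp
  next
    case (lin_span_step s v c)
    then show ?case using lin_span.lin_span_step[of s S v T c] by simp
  qed
qed

lemma lin_span_closed:
  assumes "S \<subseteq> X \<rightarrow>\<^sub>E carrier A" "F \<in> lin_span B S"
  shows "F \<in> X \<rightarrow>\<^sub>E carrier A"
  using assms(2)
proof (induction rule: lin_span.induct)
  case (lin_span_step s v c)
  have "s x \<in> carrier A" "v x \<in> carrier A" if "x \<in> X" for x
    using assms(1) lin_span_step that by blast+
  then show ?case by (auto simp: bounded_ops)
qed (auto simp: bounded_ops)

text \<open>The premise \<open>step\<close> takes the place of linearity of \<open>h\<close>, so
  that affine maps such as \<open>F \<mapsto> d F + G\<close> are covered besides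
  multiplications.\<close>

lemma lin_span_linear_image:
  assumes S: "S \<subseteq> X \<rightarrow>\<^sub>E carrier A" and F: "F \<in> lin_span B S"
    and zero: "h (\<lambda>x\<in>X. \<zero>) \<in> lin_span B S'"
    and step: "\<And>s v c. s \<in> S \<Longrightarrow> v \<in> X \<rightarrow>\<^sub>E carrier A \<Longrightarrow> h v \<in> lin_span B S' \<Longrightarrow>
      h (\<lambda>x\<in>X. c \<odot> s x \<oplus> v x) \<in> lin_span B S'"
  shows "h F \<in> lin_span B S'"
  using F
proof (induction rule: lin_span.induct)
  case (lin_span_step s v c)
  have "(c \<odot>\<^bsub>B\<^esub> s) \<oplus>\<^bsub>B\<^esub> v = (\<lambda>x\<in>X. c \<odot> s x \<oplus> v x)"
    by (auto simp: bounded_ops fun_eq_iff)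
  then show ?case
    using step[OF lin_span_step.hyps(1) lin_span_closed[OF S lin_span_step.hyps(2)] lin_span_step.IH, of c] by metis
qed (metis zero bounded_ops(3))

lemma lin_span_stepI:
  assumes "s \<in> S" "v \<in> lin_span B S" "\<And>x. x \<in> X \<Longrightarrow> F x = c \<odot> s x \<oplus> v x" "F \<in> extensional X"
  shows "F \<in> lin_span B S"
proof -
  have "F = (c \<odot>\<^bsub>B\<^esub> s) \<oplus>\<^bsub>B\<^esub> v"
    using assms(3,4) by (auto simp: bounded_ops fun_eq_iff extensional_def)
  then show ?thesis using lin_span.lin_span_step[OF assms(1,2)] by simp
qed

lemma lin_span_zero: "(\<lambda>x\<in>X. \<zero>) \<in> lin_span B S"
  using lin_span.lin_span_zero[of B S] by (simp add: bounded_ops)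

lemma lin_span_superset:
  assumes "S \<subseteq> X \<rightarrow>\<^sub>E carrier A" "s \<in> S"
  shows "s \<in> lin_span B S"
proof (rule lin_span_stepI[OF assms(2) lin_span_zero])
  show "s \<in> extensional X" using assms by (auto simp: PiE_def)
  show "s x = 1 \<odot> s x \<oplus> (\<lambda>x\<in>X. \<zero>) x" if "x \<in> X" for x
  proof -
    have "s x \<in> carrier A" using assms that by blast
    then show ?thesis using that by simp
  qed
qed

text \<open>The inductive definition only prepends single terms. Closure under linear combinations
  therefore needs an induction over the first summand, with the second one as starting
  value.\<close>

lemma lin_span_smult_add:
  assumes S: "S \<subseteq> X \<rightarrow>\<^sub>E carrier A" and F: "F \<in> lin_span B S" and G: "G \<in> lin_span B S"
  shows "(\<lambda>x\<in>X. d \<odot> F x \<oplus> G x) \<in> lin_span B S"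
proof (rule lin_span_linear_image[OF S F, where h = "\<lambda>F. \<lambda>x\<in>X. d \<odot> F x \<oplus> G x"])
  have G': "G x \<in> carrier A" if "x \<in> X" for x using lin_span_closed[OF S G] that by auto
  have "(\<lambda>x\<in>X. d \<odot> (\<lambda>x\<in>X. \<zero>) x \<oplus> G x) = G"
    using G' lin_span_closed[OF S G] by (auto simp: fun_eq_iff PiE_def extensional_def)
  then show "(\<lambda>x\<in>X. d \<odot> (\<lambda>x\<in>X. \<zero>) x \<oplus> G x) \<in> lin_span B S" using G by simp
  fix s v c assume s: "s \<in> S" and v: "v \<in> X \<rightarrow>\<^sub>E carrier A"
    and IH: "(\<lambda>x\<in>X. d \<odot> v x \<oplus> G x) \<in> lin_span B S"
  show "(\<lambda>x\<in>X. d \<odot> (\<lambda>x\<in>X. c \<odot> s x \<oplus> v x) x \<oplus> G x) \<in> lin_span B S"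
  proof (rule lin_span_stepI[OF s IH])
    fix x assume x: "x \<in> X"
    then have "s x \<in> carrier A" "v x \<in> carrier A" using S s v by auto
    then show "(\<lambda>x\<in>X. d \<odot> (\<lambda>x\<in>X. c \<odot> s x \<oplus> v x) x \<oplus> G x) x
        = (d * c) \<odot> s x \<oplus> (\<lambda>x\<in>X. d \<odot> v x \<oplus> G x) x"
      using x G'[OF x] by (simp add: smult_add_right smult_smult a_assoc)
  qed simp
qed

lemma lin_span_add:
  assumes S: "S \<subseteq> X \<rightarrow>\<^sub>E carrier A" and F: "F \<in> lin_span B S" and G: "G \<in> lin_span B S"
  shows "(\<lambda>x\<in>X. F x \<oplus> G x) \<in> lin_span B S"
proof -
  have "F x \<in> carrier A" if "x \<in> X" for x using lin_span_closed[OF S F] that by auto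
  then have "(\<lambda>x\<in>X. F x \<oplus> G x) = (\<lambda>x\<in>X. 1 \<odot> F x \<oplus> G x)" by (auto simp: fun_eq_iff)
  then show ?thesis using lin_span_smult_add[OF S F G, of 1] by simp
qed

text \<open>The space \<open>C(X, A)\<close> of norm-continuous functions. Continuity is expressed
  through \<open>cnorm\<close> because the type of elements of \<open>A\<close> carries no topology
  of its own.\<close>

definition C_fun :: "('x \<Rightarrow> 'a) set" where
  "C_fun = {F \<in> X \<rightarrow>\<^sub>E carrier A. \<forall>x\<in>X. ((\<lambda>y. cnorm A (F y \<ominus> F x)) \<longlongrightarrow> 0) (at x within X)}"

lemma C_funD: "F \<in> C_fun \<Longrightarrow> x \<in> X \<Longrightarrow> F x \<in> carrier A"
  by (auto simp: C_fun_def)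

lemma C_fun_limit: "F \<in> C_fun \<Longrightarrow> x \<in> X \<Longrightarrow> ((\<lambda>y. cnorm A (F y \<ominus> F x)) \<longlongrightarrow> 0) (at x within X)"
  by (auto simp: C_fun_def)

lemma C_funI:
  assumes F: "F \<in> X \<rightarrow>\<^sub>E carrier A"
    and le: "\<And>x y. x \<in> X \<Longrightarrow> y \<in> X \<Longrightarrow> cnorm A (F y \<ominus> F x) \<le> g x y"
    and g: "\<And>x. x \<in> X \<Longrightarrow> (g x \<longlongrightarrow> 0) (at x within X)"
  shows "F \<in> C_fun"
proof -
  have "((\<lambda>y. cnorm A (F y \<ominus> F x)) \<longlongrightarrow> 0) (at x within X)" if x: "x \<in> X" for x
  proof (rule tendsto_sandwich[OF _ _ tendsto_const g[OF x]])
    have "F x \<in> carrier A" if "x \<in> X" for x using F that by auto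
    then show "\<forall>\<^sub>F y in at x within X. 0 \<le> cnorm A (F y \<ominus> F x)"
      "\<forall>\<^sub>F y in at x within X. cnorm A (F y \<ominus> F x) \<le> g x y"
      using le x by (auto simp: eventually_at_filter)
  qed
  then show ?thesis using F by (simp add: C_fun_def)
qed

lemma C_fun_zero: "(\<lambda>x\<in>X. \<zero>) \<in> C_fun"
  by (rule C_funI[of _ "\<lambda>_ _. 0"]) (auto simp: a_minus_def)

lemma C_fun_smult_add:
  assumes F: "F \<in> C_fun" and G: "G \<in> C_fun"
  shows "(\<lambda>x\<in>X. c \<odot> F x \<oplus> G x) \<in> C_fun"
proof (rule C_funI)
  show "(\<lambda>x\<in>X. c \<odot> F x \<oplus> G x) \<in> X \<rightarrow>\<^sub>E carrier A"
    using C_funD[OF F] C_funD[OF G] by auto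
  fix x y assume "x \<in> X" "y \<in> X"
  then show "cnorm A ((\<lambda>x\<in>X. c \<odot> F x \<oplus> G x) y \<ominus> (\<lambda>x\<in>X. c \<odot> F x \<oplus> G x) x)
      \<le> cmod c * cnorm A (F y \<ominus> F x) + cnorm A (G y \<ominus> G x)"
    using C_funD[OF F] C_funD[OF G] cnorm_diff_add[of "c \<odot> F y" "G y" "c \<odot> F x" "G x"]
    by (simp add: cnorm_diff_smult)
next
  fix x assume x: "x \<in> X"
  have "((\<lambda>y. cmod c * cnorm A (F y \<ominus> F x) + cnorm A (G y \<ominus> G x)) \<longlongrightarrow> cmod c * 0 + 0) (at x within X)"
    using C_fun_limit[OF F x] C_fun_limit[OF G x] by (intro tendsto_intros)
  then show "((\<lambda>y. cmod c * cnorm A (F y \<ominus> F x) + cnorm A (G y \<ominus> G x)) \<longlongrightarrow> 0) (at x within X)" by simp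
qed

lemma C_fun_uminus:
  assumes F: "F \<in> C_fun"
  shows "(\<lambda>x\<in>X. \<ominus> F x) \<in> C_fun"
proof -
  have "(\<lambda>x\<in>X. \<ominus> F x) = (\<lambda>x\<in>X. (-1) \<odot> F x \<oplus> (\<lambda>x\<in>X. \<zero>) x)"
    using C_funD[OF F] by (auto simp: fun_eq_iff minus_eq_smult)
  then show ?thesis using C_fun_smult_add[OF F C_fun_zero] by simp
qed

lemma C_fun_lmult:
  assumes F: "F \<in> C_fun" and a: "a \<in> carrier A"
  shows "(\<lambda>x\<in>X. a \<otimes> F x) \<in> C_fun"
proof (rule C_funI)
  show "(\<lambda>x\<in>X. a \<otimes> F x) \<in> X \<rightarrow>\<^sub>E carrier A"
    using C_funD[OF F] a by auto
  fix x y assume "x \<in> X" "y \<in> X"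
  then show "cnorm A ((\<lambda>x\<in>X. a \<otimes> F x) y \<ominus> (\<lambda>x\<in>X. a \<otimes> F x) x) \<le> cnorm A a * cnorm A (F y \<ominus> F x)"
    using C_funD[OF F] a cnorm_mult[of a "F y \<ominus> F x"] by (simp add: mult_diff_right)
next
  fix x assume x: "x \<in> X"
  show "((\<lambda>y. cnorm A a * cnorm A (F y \<ominus> F x)) \<longlongrightarrow> 0) (at x within X)"
    using C_fun_limit[OF F x] by (rule tendsto_mult_right_zero)
qed

lemma C_fun_elem_tensor:
  assumes a: "a \<in> carrier A" and f: "continuous_on X f"
  shows "elem_tensor A X a f \<in> C_fun"
  unfolding elem_tensor_def
proof (rule C_funI)
  show "(\<lambda>x\<in>X. f x \<odot> a) \<in> X \<rightarrow>\<^sub>E carrier A" using a by auto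
  fix x y assume "x \<in> X" "y \<in> X"
  then show "cnorm A ((\<lambda>x\<in>X. f x \<odot> a) y \<ominus> (\<lambda>x\<in>X. f x \<odot> a) x) \<le> cmod (f y - f x) * cnorm A a"
    using a by (simp flip: smult_diff_left add: cnorm_smult)
next
  fix x assume x: "x \<in> X"
  have "(f \<longlongrightarrow> f x) (at x within X)" using f x by (simp add: continuous_on_def)
  then have "((\<lambda>y. cmod (f y - f x) * cnorm A a) \<longlongrightarrow> cmod (f x - f x) * cnorm A a) (at x within X)"
    by (intro tendsto_intros)
  then show "((\<lambda>y. cmod (f y - f x) * cnorm A a) \<longlongrightarrow> 0) (at x within X)" by simp
qed

lemma lin_span_C_fun:
  assumes S: "S \<subseteq> C_fun" and F: "F \<in> lin_span B S"
  shows "F \<in> C_fun"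
  using F
proof (induction rule: lin_span.induct)
  case (lin_span_step s v c)
  have "(c \<odot>\<^bsub>B\<^esub> s) \<oplus>\<^bsub>B\<^esub> v = (\<lambda>x\<in>X. c \<odot> s x \<oplus> v x)"
    by (auto simp: bounded_ops fun_eq_iff)
  moreover have "s \<in> C_fun" using lin_span_step.hyps(1) S by blast
  ultimately show ?case using C_fun_smult_add[OF _ lin_span_step.IH] by metis
qed (metis C_fun_zero bounded_ops(3))

section \<open>Compactness, partitions of unity and approximation\<close>

lemma C_fun_cover:
  assumes F: "F \<in> C_fun" and e: "0 < e"
  obtains D r where "finite D" "D \<subseteq> X" "\<And>y. y \<in> X \<Longrightarrow> \<exists>x\<in>D. dist x y < r x"
    "\<And>x y. x \<in> X \<Longrightarrow> y \<in> X \<Longrightarrow> dist x y < r x \<Longrightarrow> cnorm A (F y \<ominus> F x) < e"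
proof -
  have "\<exists>d>0. \<forall>y\<in>X. dist x y < d \<longrightarrow> cnorm A (F y \<ominus> F x) < e" if x: "x \<in> X" for x
  proof -
    obtain d where d: "d > 0" "\<And>y. y \<in> X \<Longrightarrow> y \<noteq> x \<Longrightarrow> dist y x < d \<Longrightarrow> cnorm A (F y \<ominus> F x) < e"
      using order_tendstoD(2)[OF C_fun_limit[OF F x] e] by (auto simp: eventually_at)
    \<comment> \<open>The limit at \<open>x\<close> says nothing about the point \<open>x\<close>
      itself, which the ball contains, so it is treated separately.\<close>
    have "cnorm A (F x \<ominus> F x) < e" using C_funD[OF F x] e by (simp add: a_minus_def r_neg)
    then show ?thesis using d by (metis dist_commute)
  qed
  then obtain r where r: "\<And>x. x \<in> X \<Longrightarrow> r x > 0"
    "\<And>x y. x \<in> X \<Longrightarrow> y \<in> X \<Longrightarrow> dist x y < r x \<Longrightarrow> cnorm A (F y \<ominus> F x) < e" by metis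
  obtain D where "D \<subseteq> X" "finite D" "X \<subseteq> (\<Union>x\<in>D. ball x (r x))"
    using compactE_image[OF compact, of X "\<lambda>x. ball x (r x)"] r(1) by (metis (no_types, lifting) UN_I centre_in_ball open_ball subsetI)
  then show ?thesis using r by (intro that[of D r]) fastforce+
qed

lemma C_fun_bounded:
  assumes F: "F \<in> C_fun"
  shows "F \<in> carrier B"
proof -
  obtain D r where D: "finite D" "D \<subseteq> X" "\<And>y. y \<in> X \<Longrightarrow> \<exists>x\<in>D. dist x y < r x"
    "\<And>x y. x \<in> X \<Longrightarrow> y \<in> X \<Longrightarrow> dist x y < r x \<Longrightarrow> cnorm A (F y \<ominus> F x) < 1"
    using C_fun_cover[OF F, of 1] by auto
  \<comment> \<open>The sum over the finitely many centres stands in for their maximum.\<close>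
  have "cnorm A (F y) \<le> 1 + (\<Sum>x\<in>D. cnorm A (F x))" if y: "y \<in> X" for y
  proof -
    obtain x where x: "x \<in> D" "dist x y < r x" using D(3)[OF y] by blast
    then have "x \<in> X" using D by auto
    then have "cnorm A (F y) \<le> 1 + cnorm A (F x)"
      using cnorm_le_diff[of "F y" "F x"] C_funD[OF F] y D(4)[of x y] x by fastforce
    also have "cnorm A (F x) \<le> (\<Sum>x\<in>D. cnorm A (F x))"
      using x(1) D C_funD[OF F] by (intro member_le_sum) auto
    finally show ?thesis by simp
  qed
  then show ?thesis
    using F by (auto simp: bounded_functions_def C_fun_def bdd_above_def)
qed

lemma cnorm_B_le:
  assumes "\<And>x. x \<in> X \<Longrightarrow> cnorm A (F x) \<le> e"
  shows "cnorm B F \<le> e"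
  using nonempty assms by (auto simp: bounded_functions_def intro!: cSUP_least)

lemma cnorm_B_ge:
  assumes "F \<in> carrier B" "x \<in> X"
  shows "cnorm A (F x) \<le> cnorm B F"
  using assms by (auto simp: bounded_functions_def intro!: cSUP_upper)

lemma minus_B:
  assumes F: "G \<in> C_fun"
  shows "F \<ominus>\<^bsub>B\<^esub> G = (\<lambda>x\<in>X. F x \<ominus> G x)"
proof (rule a_minus_pointwise[OF ring_axioms])
  show "G \<in> X \<rightarrow>\<^sub>E carrier A" using F by (simp add: C_fun_def)
qed (use C_fun_bounded[OF C_fun_uminus[OF F]] in \<open>auto simp: bounded_functions_def\<close>)

abbreviation (input) elementary where
  "elementary \<equiv> {elem_tensor A X a f | a f. a \<in> carrier A \<and> continuous_on X f}"

lemma elementary_C_fun: "elementary \<subseteq> C_fun"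
  using C_fun_elem_tensor by auto

lemma C_fun_PiE: "C_fun \<subseteq> X \<rightarrow>\<^sub>E carrier A"
  by (auto simp: C_fun_def)

text \<open>The function \<open>G\<close> is the sum of the elementary tensors with factors
  \<open>a i\<close> and \<open>g i\<close>. Neither are the weights normalised nor is
  \<open>y\<close> tied to a function, so that the induction over \<open>D\<close> goes through;
  with weights of sum one and \<open>y = F x\<close> this becomes the usual estimate for a partition
  of unity.\<close>

lemma weighted_average:
  assumes "finite D" and a: "\<And>i. i \<in> D \<Longrightarrow> a i \<in> carrier A"
    and cont: "\<And>i. i \<in> D \<Longrightarrow> continuous_on X (g i)" and nonneg: "\<And>i x. i \<in> D \<Longrightarrow> x \<in> X \<Longrightarrow> 0 \<le> g i x"
  shows "\<exists>G \<in> lin_span B elementary. \<forall>x\<in>X. \<forall>y\<in>carrier A.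
    cnorm A (complex_of_real (\<Sum>i\<in>D. g i x) \<odot> y \<ominus> G x) \<le> (\<Sum>i\<in>D. g i x * cnorm A (y \<ominus> a i))"
  using assms
proof (induction D rule: finite_induct)
  case empty
  show ?case by (rule bexI[OF _ lin_span_zero]) (auto simp: a_minus_def)
next
  case (insert i D)
  then obtain G where G: "G \<in> lin_span B elementary"
    and le: "\<And>x y. x \<in> X \<Longrightarrow> y \<in> carrier A \<Longrightarrow>
      cnorm A (complex_of_real (\<Sum>i\<in>D. g i x) \<odot> y \<ominus> G x) \<le> (\<Sum>i\<in>D. g i x * cnorm A (y \<ominus> a i))" by auto
  let ?H = "\<lambda>x\<in>X. 1 \<odot> elem_tensor A X (a i) (\<lambda>x. of_real (g i x)) x \<oplus> G x"
  have ai: "a i \<in> carrier A" using insert by auto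
  have "elem_tensor A X (a i) (\<lambda>x. of_real (g i x)) \<in> elementary"
    using insert.prems by (auto intro!: exI[of _ "a i"] exI[of _ "\<lambda>x. of_real (g i x)"] continuous_intros)
  then have "?H \<in> lin_span B elementary" by (rule lin_span_stepI[OF _ G]) auto
  moreover have "cnorm A (complex_of_real (\<Sum>i\<in>insert i D. g i x) \<odot> y \<ominus> ?H x)
      \<le> (\<Sum>i\<in>insert i D. g i x * cnorm A (y \<ominus> a i))" if x: "x \<in> X" and y: "y \<in> carrier A" for x y
  proof -
    have Gx: "G x \<in> carrier A"
      using lin_span_closed[OF order_trans[OF elementary_C_fun C_fun_PiE] G] x by auto
    have "cnorm A (complex_of_real (\<Sum>i\<in>insert i D. g i x) \<odot> y \<ominus> ?H x) =
        cnorm A ((of_real (g i x) \<odot> y \<oplus> of_real (\<Sum>i\<in>D. g i x) \<odot> y) \<ominus> (of_real (g i x) \<odot> a i \<oplus> G x))"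
      using insert.hyps x y ai by (simp add: smult_add_left elem_tensor_def)
    also have "\<dots> \<le> cnorm A (of_real (g i x) \<odot> y \<ominus> of_real (g i x) \<odot> a i) +
        cnorm A (of_real (\<Sum>i\<in>D. g i x) \<odot> y \<ominus> G x)"
      using y ai Gx by (intro cnorm_diff_add) auto
    also have "\<dots> \<le> g i x * cnorm A (y \<ominus> a i) + (\<Sum>i\<in>D. g i x * cnorm A (y \<ominus> a i))"
      using le[OF x y] insert.prems x y ai by (simp add: cnorm_diff_smult)
    finally show ?thesis using insert.hyps by simp
  qed
  ultimately show ?case by blast
qed

text \<open>Partition of unity subordinate to a finite cover on whose members \<open>F\<close> varies by less than
  \<open>e\<close>.\<close>

lemma C_fun_approx:
  assumes F: "F \<in> C_fun" and e: "0 < e"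
  obtains G where "G \<in> lin_span B elementary" "\<And>x. x \<in> X \<Longrightarrow> cnorm A (F x \<ominus> G x) \<le> e"
proof -
  obtain D r where D: "finite D" "D \<subseteq> X" "\<And>y. y \<in> X \<Longrightarrow> \<exists>x\<in>D. dist x y < r x"
    "\<And>x y. x \<in> X \<Longrightarrow> y \<in> X \<Longrightarrow> dist x y < r x \<Longrightarrow> cnorm A (F y \<ominus> F x) < e"
    using C_fun_cover[OF F e] by blast
  \<comment> \<open>Tent functions: \<open>b i\<close> is positive exactly on the ball of radius
    \<open>r i\<close> around \<open>i\<close>. Their sum \<open>s\<close> is thus positive on
    \<open>X\<close> and can be divided by, and terms with \<open>x\<close> outside the ball drop
    out of the average.\<close>
  define b where "b i x = max 0 (r i - dist i x)" for i x
  define s where "s x = (\<Sum>i\<in>D. b i x)" for x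
  have b0: "0 \<le> b i x" for i x by (simp add: b_def)
  have s0: "0 < s x" if x: "x \<in> X" for x
  proof -
    obtain i where "i \<in> D" "dist i x < r i" using D(3)[OF x] by blast
    then show ?thesis unfolding s_def using D(1) b0 by (intro sum_pos2[of _ i]) (auto simp: b_def)
  qed
  have cb: "continuous_on X (b i)" for i unfolding b_def by (intro continuous_intros)
  have cs: "continuous_on X s" unfolding s_def by (intro continuous_intros cb)
  have "\<exists>G \<in> lin_span B elementary. \<forall>x\<in>X. \<forall>y\<in>carrier A.
    cnorm A (complex_of_real (\<Sum>i\<in>D. b i x / s x) \<odot> y \<ominus> G x) \<le> (\<Sum>i\<in>D. b i x / s x * cnorm A (y \<ominus> F i))"
  proof (rule weighted_average[OF D(1)])
    show "F i \<in> carrier A" if "i \<in> D" for i using C_funD[OF F] D(2) that by auto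
    show "continuous_on X (\<lambda>x. b i x / s x)" for i
      using s0 by (intro continuous_intros cb cs) fastforce
    show "0 \<le> b i x / s x" if "x \<in> X" for i x using b0 s0[OF that] by (simp add: less_imp_le)
  qed
  then obtain G where G: "G \<in> lin_span B elementary"
    and le: "\<And>x y. x \<in> X \<Longrightarrow> y \<in> carrier A \<Longrightarrow>
      cnorm A (complex_of_real (\<Sum>i\<in>D. b i x / s x) \<odot> y \<ominus> G x) \<le> (\<Sum>i\<in>D. b i x / s x * cnorm A (y \<ominus> F i))"
    by blast
  have "cnorm A (F x \<ominus> G x) \<le> e" if x: "x \<in> X" for x
  proof -
    have sum1: "(\<Sum>i\<in>D. b i x / s x) = 1"
      using s0[OF x] by (simp add: s_def flip: sum_divide_distrib)
    have "cnorm A (F x \<ominus> G x) \<le> (\<Sum>i\<in>D. b i x / s x * cnorm A (F x \<ominus> F i))"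
      using le[OF x C_funD[OF F x]] C_funD[OF F x] unfolding sum1 by simp
    also have "\<dots> \<le> (\<Sum>i\<in>D. b i x / s x * e)"
    proof (rule sum_mono)
      fix i assume i: "i \<in> D"
      show "b i x / s x * cnorm A (F x \<ominus> F i) \<le> b i x / s x * e"
      proof (cases "dist i x < r i")
        case True
        then have "cnorm A (F x \<ominus> F i) < e" using D x i by auto
        then show ?thesis using b0 s0[OF x] by (intro mult_left_mono) (auto simp: less_imp_le)
      qed (simp add: b_def)
    qed
    also have "\<dots> = (\<Sum>i\<in>D. b i x / s x) * e" by (rule sum_distrib_right[symmetric])
    also have "\<dots> = e" by (simp only: sum1 mult_1)
    finally show ?thesis .
  qed
  with G show ?thesis by (rule that)
qed

text \<open>This is what places the orbit maps of a continuous action inside the tensor product, so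
  that the associated coaction has the right codomain.\<close>

lemma C_fun_in_tensor:
  assumes F: "F \<in> C_fun"
  shows "F \<in> carrier T"
proof -
  have "\<exists>G\<in>lin_span B elementary. cnorm B (F \<ominus>\<^bsub>B\<^esub> G) < e" if e: "0 < e" for e
  proof -
    obtain G where G: "G \<in> lin_span B elementary" "\<And>x. x \<in> X \<Longrightarrow> cnorm A (F x \<ominus> G x) \<le> e / 2"
      using C_fun_approx[OF F, of "e / 2"] e by auto
    have "cnorm B (F \<ominus>\<^bsub>B\<^esub> G) \<le> e / 2"
      using G by (intro cnorm_B_le) (simp add: minus_B[OF lin_span_C_fun[OF elementary_C_fun]])
    then show ?thesis using G(1) e by (intro bexI[of _ G]) auto
  qed
  then show ?thesis
    using C_fun_bounded[OF F] by (simp add: tensor_C_def norm_closure_def)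
qed

lemma minus_T:
  assumes F: "G \<in> C_fun"
  shows "F \<ominus>\<^bsub>T\<^esub> G = (\<lambda>x\<in>X. F x \<ominus> G x)"
proof (rule a_minus_pointwise[OF ring_axioms])
  show "G \<in> X \<rightarrow>\<^sub>E carrier A" using F by (simp add: C_fun_def)
  show "carrier T \<subseteq> X \<rightarrow>\<^sub>E carrier A"
    by (auto simp: tensor_C_def norm_closure_def bounded_functions_def)
qed (use C_fun_in_tensor[OF C_fun_uminus[OF F]] in \<open>auto simp: bounded_ops\<close>)

text \<open>Elementary tensors span a dense subspace by construction, so it is enough that each of
  them is a uniform limit of elements of \<open>E\<close>. That \<open>E\<close> is a subspace is
  expressed by \<open>lin_span B E = E\<close>.\<close>

lemma dense_in_tensor:
  assumes E: "E \<subseteq> C_fun" and span: "lin_span B E = E"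
    and approx: "\<And>a f e. a \<in> carrier A \<Longrightarrow> continuous_on X f \<Longrightarrow> 0 < e \<Longrightarrow>
      \<exists>H\<in>E. \<forall>x\<in>X. cnorm A (f x \<odot> a \<ominus> H x) \<le> e"
  shows "norm_closure T E = carrier T"
proof
  show "norm_closure T E \<subseteq> carrier T" by (auto simp: norm_closure_def)
  have ES: "E \<subseteq> X \<rightarrow>\<^sub>E carrier A" using E C_fun_PiE by blast
  have zero_mem: "(\<lambda>x\<in>X. \<zero>) \<in> E" using lin_span_zero[of E] span by simp
  have span_approx: "\<forall>e>0. \<exists>H\<in>E. \<forall>x\<in>X. cnorm A (G x \<ominus> H x) \<le> e" if "G \<in> lin_span B elementary" for G
    using that
  proof (induction rule: lin_span.induct)
    case lin_span_zero
    show ?case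
      using zero_mem by (intro allI impI bexI[of _ "\<lambda>x\<in>X. \<zero>"]) (auto simp: bounded_ops a_minus_def)
  next
    case (lin_span_step s v c)
    show ?case
    proof (intro allI impI)
      fix e :: real assume e: "0 < e"
      obtain a f where s: "s = elem_tensor A X a f" and a: "a \<in> carrier A" and f: "continuous_on X f"
        using lin_span_step.hyps by auto
      \<comment> \<open>The summand \<open>1\<close> in the denominator covers the coefficient
        \<open>c = 0\<close>.\<close>
      obtain H where H: "H \<in> E" "\<And>x. x \<in> X \<Longrightarrow> cnorm A (f x \<odot> a \<ominus> H x) \<le> e / (2 * (cmod c + 1))"
        using approx[OF a f, of "e / (2 * (cmod c + 1))"] e by (auto simp: add_nonneg_pos)
      obtain K where K: "K \<in> E" "\<And>x. x \<in> X \<Longrightarrow> cnorm A (v x \<ominus> K x) \<le> e / 2"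
        using lin_span_step.IH e by (meson half_gt_zero)
      have vC: "v \<in> X \<rightarrow>\<^sub>E carrier A"
        using lin_span_closed[OF order_trans[OF elementary_C_fun C_fun_PiE] lin_span_step.hyps(2)] .
      have "(\<lambda>x\<in>X. c \<odot> H x \<oplus> K x) \<in> E"
        using lin_span_smult_add[OF ES, of H K c] H K span by simp
      moreover have "cnorm A (((c \<odot>\<^bsub>B\<^esub> s) \<oplus>\<^bsub>B\<^esub> v) x \<ominus> (\<lambda>x\<in>X. c \<odot> H x \<oplus> K x) x) \<le> e" if x: "x \<in> X" for x
      proof -
        have cl: "H x \<in> carrier A" "K x \<in> carrier A" "v x \<in> carrier A" using H K ES x vC by auto
        have "cnorm A (((c \<odot>\<^bsub>B\<^esub> s) \<oplus>\<^bsub>B\<^esub> v) x \<ominus> (\<lambda>x\<in>X. c \<odot> H x \<oplus> K x) x)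
            = cnorm A ((c \<odot> (f x \<odot> a) \<oplus> v x) \<ominus> (c \<odot> H x \<oplus> K x))"
          using x by (simp add: bounded_ops s elem_tensor_def)
        also have "\<dots> \<le> cmod c * cnorm A (f x \<odot> a \<ominus> H x) + cnorm A (v x \<ominus> K x)"
          using cnorm_diff_add[of "c \<odot> (f x \<odot> a)" "v x" "c \<odot> H x" "K x"] cl a
          by (simp add: cnorm_diff_smult)
        also have "\<dots> \<le> (cmod c + 1) * (e / (2 * (cmod c + 1))) + e / 2"
          using H(2)[OF x] K(2)[OF x] cl a by (intro add_mono mult_mono) auto
        also have "(cmod c + 1) * (e / (2 * (cmod c + 1))) = e / 2"
          by (simp add: add_nonneg_eq_0_iff divide_simps)
        finally show ?thesis by simp
      qed
      ultimately show "\<exists>H\<in>E. \<forall>x\<in>X. cnorm A (((c \<odot>\<^bsub>B\<^esub> s) \<oplus>\<^bsub>B\<^esub> v) x \<ominus> H x) \<le> e" by blast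
    qed
  qed
  show "carrier T \<subseteq> norm_closure T E"
  proof
    fix F assume F: "F \<in> carrier T"
    then have FX: "F x \<in> carrier A" if "x \<in> X" for x
      using that by (auto simp: tensor_C_def norm_closure_def bounded_functions_def)
    have "\<exists>H\<in>E. cnorm T (F \<ominus>\<^bsub>T\<^esub> H) < e" if e: "0 < e" for e
    proof -
      obtain G where G: "G \<in> lin_span B elementary" "cnorm B (F \<ominus>\<^bsub>B\<^esub> G) < e / 3"
        using F e by (auto simp: tensor_C_def norm_closure_def dest!: spec[of _ "e / 3"])
      obtain H where H: "H \<in> E" "\<And>x. x \<in> X \<Longrightarrow> cnorm A (G x \<ominus> H x) \<le> e / 3"
        using span_approx[OF G(1)] e by (meson divide_pos_pos zero_less_numeral)
      have GC: "G \<in> C_fun" by (rule lin_span_C_fun[OF elementary_C_fun G(1)])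
      have HC: "H \<in> C_fun" using H(1) E by auto
      \<comment> \<open>A supremum dominates the pointwise values only if these are bounded; this
        has to be known before the norm estimate for the difference can be read pointwise.\<close>
      have bd: "F \<ominus>\<^bsub>B\<^esub> G \<in> carrier B"
      proof -
        have FB: "F \<in> carrier B" using F by (auto simp: tensor_C_def norm_closure_def)
        have "cnorm A (F x \<ominus> G x) \<le> cnorm B F + cnorm B G" if x: "x \<in> X" for x
        proof -
          have "cnorm A (F x \<ominus> G x) \<le> cnorm A (F x) + cnorm A (G x)"
            using cnorm_add[of "F x" "\<ominus> G x"] FX[OF x] C_funD[OF GC x] by (simp add: a_minus_def)
          also have "\<dots> \<le> cnorm B F + cnorm B G"
            by (intro add_mono cnorm_B_ge FB C_fun_bounded GC x)
          finally show ?thesis .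
        qed
        then show ?thesis
          using FX C_funD[OF GC] unfolding minus_B[OF GC]
          by (auto simp: bounded_functions_def bdd_above_def)
      qed
      have "cnorm A ((F \<ominus>\<^bsub>T\<^esub> H) x) \<le> 2 * e / 3" if x: "x \<in> X" for x
      proof -
        have "cnorm A (F x \<ominus> G x) \<le> e / 3"
          using cnorm_B_ge[OF bd x] G(2) x by (simp add: minus_B[OF GC])
        then show ?thesis
          using cnorm_triangle[OF FX[OF x] C_funD[OF GC x] C_funD[OF HC x]] H(2)[OF x] x
          by (simp add: minus_T[OF HC])
      qed
      then have "cnorm T (F \<ominus>\<^bsub>T\<^esub> H) \<le> 2 * e / 3" unfolding tensor_ops by (rule cnorm_B_le)
      then show ?thesis using H(1) e by (intro bexI[of _ H]) auto
    qed
    then show "F \<in> norm_closure T E" using F by (simp add: norm_closure_def)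
  qed
qed

end

section \<open>Freeness of circle actions\<close>

locale circle_action_locale =
  fixes A :: "('a, 'm) cstar_scheme" (structure) and \<mu>
  assumes action: "circle_action A \<mu>"
begin

sublocale cstar_functions A U1
proof
  show "cstar_algebra A" using action by (simp add: circle_action_def)
  show "U1 \<noteq> {}" using norm_one by (metis dist_0_norm empty_iff mem_sphere)
qed simp

lemma action_closed [simp]: "w \<in> U1 \<Longrightarrow> a \<in> carrier A \<Longrightarrow> \<mu> w a \<in> carrier A"
  and action_mult: "w \<in> U1 \<Longrightarrow> a \<in> carrier A \<Longrightarrow> b \<in> carrier A \<Longrightarrow> \<mu> w (a \<otimes> b) = \<mu> w a \<otimes> \<mu> w b"
  and action_add: "w \<in> U1 \<Longrightarrow> a \<in> carrier A \<Longrightarrow> b \<in> carrier A \<Longrightarrow> \<mu> w (a \<oplus> b) = \<mu> w a \<oplus> \<mu> w b"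
  and action_one: "w \<in> U1 \<Longrightarrow> \<mu> w \<one> = \<one>"
  and action_smult: "w \<in> U1 \<Longrightarrow> a \<in> carrier A \<Longrightarrow> \<mu> w (c \<odot> a) = c \<odot> \<mu> w a"
  and action_adj: "w \<in> U1 \<Longrightarrow> a \<in> carrier A \<Longrightarrow> \<mu> w (adj A a) = adj A (\<mu> w a)"
  using action unfolding circle_action_def star_hom_def
  by (auto dest: ring_hom_closed ring_hom_mult ring_hom_add ring_hom_one)

lemma orbit_C_fun: "a \<in> carrier A \<Longrightarrow> coaction_of \<mu> a \<in> C_fun"
  using action unfolding circle_action_def
  by (intro C_funI[of _ "\<lambda>w v. cnorm A (\<mu> v a \<ominus> \<mu> w a)"]) (auto simp: coaction_of_def)

text \<open>All algebraic laws hold pointwise in \<open>w\<close>. The analytic content, that the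
  values lie in the tensor product, is the continuity of the orbits.\<close>

lemma circle_coaction: "circle_coaction A (coaction_of \<mu>)"
  unfolding circle_coaction_def
proof (intro conjI ballI)
  show "star_hom A (tensor_C A U1) (coaction_of \<mu>)"
    unfolding star_hom_def
    by (auto intro!: ring_hom_memI C_fun_in_tensor orbit_C_fun
        simp: bounded_ops fun_eq_iff coaction_of_def action_mult action_add action_one action_smult action_adj)
  fix a v w assume a: "a \<in> carrier A"
  show "coaction_of \<mu> a 1 = a"
    using action a by (simp add: coaction_of_def circle_action_def)
  assume "v \<in> U1" "w \<in> U1"
  then show "coaction_of \<mu> (coaction_of \<mu> a w) v = coaction_of \<mu> a (v * w)"
    using action a by (simp add: coaction_of_def circle_action_def norm_mult)
qed (rule cstar)

definition orbit_functions :: "(complex \<Rightarrow> 'a) set" where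
  "orbit_functions = {(\<lambda>w\<in>U1. a \<otimes> \<mu> w b) | a b. a \<in> carrier A \<and> b \<in> carrier A}"

abbreviation (input) E where "E \<equiv> lin_span B orbit_functions"

lemma ellwood_image_eq: "ellwood_image A (coaction_of \<mu>) = E"
proof -
  have "elem_tensor A U1 a (\<lambda>_. 1) \<otimes>\<^bsub>B\<^esub> coaction_of \<mu> b = (\<lambda>w\<in>U1. a \<otimes> \<mu> w b)"
    if "a \<in> carrier A" for a b
    using that by (auto simp: bounded_ops elem_tensor_def coaction_of_def fun_eq_iff)
  then have "{elem_tensor A U1 a (\<lambda>_. 1) \<otimes>\<^bsub>B\<^esub> coaction_of \<mu> b |a b. a \<in> carrier A \<and> b \<in> carrier A}
      = orbit_functions"
    unfolding orbit_functions_def by (intro Collect_cong) metis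
  then show ?thesis by (simp add: ellwood_image_def lin_span_tensor)
qed

lemma orbit_functions_C_fun: "orbit_functions \<subseteq> C_fun"
proof -
  have "(\<lambda>w\<in>U1. a \<otimes> \<mu> w b) \<in> C_fun" if "a \<in> carrier A" "b \<in> carrier A" for a b
  proof -
    have "(\<lambda>w\<in>U1. a \<otimes> \<mu> w b) = (\<lambda>w\<in>U1. a \<otimes> coaction_of \<mu> b w)"
      by (auto simp: coaction_of_def fun_eq_iff)
    then show ?thesis using C_fun_lmult[OF orbit_C_fun that(1), of b] that by simp
  qed
  then show ?thesis by (auto simp: orbit_functions_def)
qed

lemma orbit_functions_PiE: "orbit_functions \<subseteq> U1 \<rightarrow>\<^sub>E carrier A"
  using orbit_functions_C_fun C_fun_PiE by blast

lemma orbit_function_mem: "a \<in> carrier A \<Longrightarrow> b \<in> carrier A \<Longrightarrow> (\<lambda>w\<in>U1. a \<otimes> \<mu> w b) \<in> E"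
  by (rule lin_span_superset[OF orbit_functions_PiE]) (auto simp: orbit_functions_def)

lemma lmult_mem:
  assumes F: "F \<in> E" and a: "a \<in> carrier A"
  shows "(\<lambda>w\<in>U1. a \<otimes> F w) \<in> E"
proof (rule lin_span_linear_image[OF orbit_functions_PiE F, where h = "\<lambda>F. \<lambda>w\<in>U1. a \<otimes> F w"])
  have "(\<lambda>w\<in>U1. a \<otimes> (\<lambda>w\<in>U1. \<zero>) w) = (\<lambda>w\<in>U1. \<zero>)" using a by (auto simp: fun_eq_iff)
  then show "(\<lambda>w\<in>U1. a \<otimes> (\<lambda>w\<in>U1. \<zero>) w) \<in> E" using lin_span_zero by simp
  fix s v c assume s: "s \<in> orbit_functions" and v: "v \<in> U1 \<rightarrow>\<^sub>E carrier A" and IH: "(\<lambda>w\<in>U1. a \<otimes> v w) \<in> E"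
  obtain b d where s_eq: "s = (\<lambda>w\<in>U1. b \<otimes> \<mu> w d)" and bd: "b \<in> carrier A" "d \<in> carrier A"
    using s by (auto simp: orbit_functions_def)
  have "(\<lambda>w\<in>U1. (a \<otimes> b) \<otimes> \<mu> w d) \<in> orbit_functions" using a bd by (auto simp: orbit_functions_def)
  then show "(\<lambda>w\<in>U1. a \<otimes> (\<lambda>w\<in>U1. c \<odot> s w \<oplus> v w) w) \<in> E"
  proof (rule lin_span_stepI[OF _ IH])
    fix w :: complex assume w: "w \<in> U1"
    then have "v w \<in> carrier A" "\<mu> w d \<in> carrier A" using v bd by auto
    then show "(\<lambda>w\<in>U1. a \<otimes> (\<lambda>w\<in>U1. c \<odot> s w \<oplus> v w) w) w =
        c \<odot> (\<lambda>w\<in>U1. (a \<otimes> b) \<otimes> \<mu> w d) w \<oplus> (\<lambda>w\<in>U1. a \<otimes> v w) w"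
      using w a bd by (simp add: s_eq r_distr smult_mult_right m_assoc)
  qed simp
qed

section \<open>Scalar functions in the span of the orbit functions\<close>

abbreviation (input) scalar :: "(complex \<Rightarrow> complex) \<Rightarrow> complex \<Rightarrow> 'a" where
  "scalar f \<equiv> \<lambda>w\<in>U1. f w \<odot> \<one>"

text \<open>A product \<open>a \<mu>\<^sub>w(b) c \<mu>\<^sub>w(d)\<close> of orbit functions is not
  visibly in \<open>E\<close>, since \<open>c\<close> stands in the middle. A scalar factor is
  central and can be put there instead: \<open>f(w) a \<mu>\<^sub>w(b)\<close> arises from the
  scalar function by multiplying with \<open>a\<close> on the left and with
  \<open>\<mu>\<^sub>w(b)\<close> on the right, and both operations preserve
  \<open>E\<close>.\<close>

lemma scalar_mult_mem:
  assumes f: "scalar f \<in> E" and F: "F \<in> E"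
  shows "(\<lambda>w\<in>U1. f w \<odot> F w) \<in> E"
proof -
  have orbit: "(\<lambda>w\<in>U1. f w \<odot> (a \<otimes> \<mu> w b)) \<in> E" if a: "a \<in> carrier A" and b: "b \<in> carrier A" for a b
  proof -
    \<comment> \<open>The reason is multiplicativity of the action:
      \<open>a' \<mu>\<^sub>w(d) \<mu>\<^sub>w(b) = a' \<mu>\<^sub>w(d b)\<close>.\<close>
    have rmult: "(\<lambda>w\<in>U1. F w \<otimes> \<mu> w b) \<in> E" if F: "F \<in> E" for F
    proof (rule lin_span_linear_image[OF orbit_functions_PiE F, where h = "\<lambda>F. \<lambda>w\<in>U1. F w \<otimes> \<mu> w b"])
      have "(\<lambda>w\<in>U1. (\<lambda>w\<in>U1. \<zero>) w \<otimes> \<mu> w b) = (\<lambda>w\<in>U1. \<zero>)" using b by (auto simp: fun_eq_iff)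
      then show "(\<lambda>w\<in>U1. (\<lambda>w\<in>U1. \<zero>) w \<otimes> \<mu> w b) \<in> E" using lin_span_zero by simp
      fix s v c assume s: "s \<in> orbit_functions" and v: "v \<in> U1 \<rightarrow>\<^sub>E carrier A"
        and IH: "(\<lambda>w\<in>U1. v w \<otimes> \<mu> w b) \<in> E"
      obtain a' d where s_eq: "s = (\<lambda>w\<in>U1. a' \<otimes> \<mu> w d)" and ad: "a' \<in> carrier A" "d \<in> carrier A"
        using s by (auto simp: orbit_functions_def)
      have "(\<lambda>w\<in>U1. a' \<otimes> \<mu> w (d \<otimes> b)) \<in> orbit_functions" using b ad by (auto simp: orbit_functions_def)
      then show "(\<lambda>w\<in>U1. (\<lambda>w\<in>U1. c \<odot> s w \<oplus> v w) w \<otimes> \<mu> w b) \<in> E"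
      proof (rule lin_span_stepI[OF _ IH])
        fix w :: complex assume w: "w \<in> U1"
        then have "v w \<in> carrier A" "\<mu> w d \<in> carrier A" "\<mu> w b \<in> carrier A" using v ad b by auto
        then show "(\<lambda>w\<in>U1. (\<lambda>w\<in>U1. c \<odot> s w \<oplus> v w) w \<otimes> \<mu> w b) w =
            c \<odot> (\<lambda>w\<in>U1. a' \<otimes> \<mu> w (d \<otimes> b)) w \<oplus> (\<lambda>w\<in>U1. v w \<otimes> \<mu> w b) w"
          using w ad b by (simp add: s_eq l_distr smult_mult_left m_assoc action_mult)
      qed simp
    qed
    have "(\<lambda>w\<in>U1. f w \<odot> (a \<otimes> \<mu> w b)) = (\<lambda>w\<in>U1. (\<lambda>w\<in>U1. a \<otimes> scalar f w) w \<otimes> \<mu> w b)"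
      using a b by (auto simp: fun_eq_iff smult_mult_left smult_mult_right)
    then show ?thesis using rmult[OF lmult_mem[OF f a]] by simp
  qed
  show ?thesis
  proof (rule lin_span_linear_image[OF orbit_functions_PiE F, where h = "\<lambda>F. \<lambda>w\<in>U1. f w \<odot> F w"])
    have "(\<lambda>w\<in>U1. f w \<odot> (\<lambda>w\<in>U1. \<zero>) w) = (\<lambda>w\<in>U1. \<zero>)" by (auto simp: fun_eq_iff)
    then show "(\<lambda>w\<in>U1. f w \<odot> (\<lambda>w\<in>U1. \<zero>) w) \<in> E" using lin_span_zero by simp
    fix s v c assume s: "s \<in> orbit_functions" and v: "v \<in> U1 \<rightarrow>\<^sub>E carrier A" and IH: "(\<lambda>w\<in>U1. f w \<odot> v w) \<in> E"
    obtain a b where s_eq: "s = (\<lambda>w\<in>U1. a \<otimes> \<mu> w b)" and ab: "a \<in> carrier A" "b \<in> carrier A"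
      using s by (auto simp: orbit_functions_def)
    have "(\<lambda>w\<in>U1. f w \<odot> (\<lambda>w\<in>U1. c \<odot> s w \<oplus> v w) w) =
        (\<lambda>w\<in>U1. c \<odot> (\<lambda>w\<in>U1. f w \<odot> (a \<otimes> \<mu> w b)) w \<oplus> (\<lambda>w\<in>U1. f w \<odot> v w) w)"
    proof (rule restrict_ext)
      fix w :: complex assume w: "w \<in> U1"
      then have "v w \<in> carrier A" using v by auto
      then show "f w \<odot> (\<lambda>w\<in>U1. c \<odot> s w \<oplus> v w) w =
          c \<odot> (\<lambda>w\<in>U1. f w \<odot> (a \<otimes> \<mu> w b)) w \<oplus> (\<lambda>w\<in>U1. f w \<odot> v w) w"
        using w ab by (simp add: s_eq smult_add_right smult_smult mult.commute)
    qed
    then show "(\<lambda>w\<in>U1. f w \<odot> (\<lambda>w\<in>U1. c \<odot> s w \<oplus> v w) w) \<in> E"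
      using lin_span_smult_add[OF orbit_functions_PiE orbit[OF ab] IH] by simp
  qed
qed

lemma scalar_mult:
  assumes "scalar f \<in> E" "scalar g \<in> E"
  shows "scalar (\<lambda>w. f w * g w) \<in> E"
proof -
  have "scalar (\<lambda>w. f w * g w) = (\<lambda>w\<in>U1. f w \<odot> scalar g w)" by (auto simp: fun_eq_iff smult_smult)
  then show ?thesis using scalar_mult_mem[OF assms] by simp
qed

lemma scalar_smult_add:
  assumes "scalar f \<in> E" "scalar g \<in> E"
  shows "scalar (\<lambda>w. c * f w + g w) \<in> E"
proof -
  have "scalar (\<lambda>w. c * f w + g w) = (\<lambda>w\<in>U1. c \<odot> scalar f w \<oplus> scalar g w)"
    by (auto simp: fun_eq_iff smult_smult smult_add_left)
  then show ?thesis using lin_span_smult_add[OF orbit_functions_PiE assms] by simp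
qed

lemma scalar_const: "scalar (\<lambda>_. c) \<in> E"
proof -
  have "scalar (\<lambda>_. c) = (\<lambda>w\<in>U1. (c \<odot> \<one>) \<otimes> \<mu> w \<one>)" by (auto simp: fun_eq_iff action_one)
  then show ?thesis using orbit_function_mem[of "c \<odot> \<one>" \<one>] by simp
qed

text \<open>Only the linear case uses \<open>id\<close> and \<open>cnj\<close>: a real-linear
  functional on the plane is a complex combination of \<open>w\<close> and \<open>cnj w\<close>.
  Sums and products stay in \<open>E\<close> by the algebra property of scalar functions.\<close>

lemma scalar_polynomial:
  assumes id: "scalar (\<lambda>w. w) \<in> E" and cnj: "scalar cnj \<in> E" and g: "real_polynomial_function g"
  shows "scalar (\<lambda>w. of_real (g w)) \<in> E"
  using g
proof (induction rule: real_polynomial_function.induct)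
  case (linear f)
  interpret bounded_linear f by fact
  \<comment> \<open>The coefficients come from inserting \<open>Re w = (w + cnj w) / 2\<close> and
    \<open>Im w = (w - cnj w) / (2 \<i>)\<close> into
    \<open>f w = Re w * f 1 + Im w * f \<i>\<close>. The summand \<open>0\<close> in the next
    equation is a constant from which the combination is built up.\<close>
  obtain a b where ab: "a = of_real (f 1) / 2 - \<i> * of_real (f \<i>) / 2"
    "b = of_real (f 1) / 2 + \<i> * of_real (f \<i>) / 2" by blast
  have eq: "complex_of_real (f w) = a * w + (b * cnj w + 0)" for w
  proof -
    have "w = Re w *\<^sub>R 1 + Im w *\<^sub>R \<i>" by (simp add: complex_eq_iff)
    then have "f w = Re w * f 1 + Im w * f \<i>" by (metis add scaleR real_scaleR_def)
    then show ?thesis unfolding ab by (simp add: complex_eq_iff algebra_simps)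
  qed
  show ?case unfolding eq by (rule scalar_smult_add[OF id scalar_smult_add[OF cnj scalar_const]])
next
  case (add f g)
  then show ?case
    using scalar_smult_add[of "\<lambda>w. of_real (f w)" "\<lambda>w. of_real (g w)" 1] unfolding mult_1 of_real_add by blast
next
  case (mult f g)
  then show ?case unfolding of_real_mult by (intro scalar_mult)
qed (rule scalar_const)

text \<open>The Stone-Weierstrass theorem is applied to real functions, once for the real and once
  for the imaginary part of \<open>f\<close>. Multiplying the resulting scalar function by
  \<open>a\<close> from the left then approximates the elementary tensor.\<close>

theorem free_if_scalar_mem:
  assumes id: "scalar (\<lambda>w. w) \<in> E" and cnj: "scalar cnj \<in> E"
  shows "free_circle_action A \<mu>"
proof -
  have span: "lin_span B E = E"
  proof
    have E: "E \<subseteq> U1 \<rightarrow>\<^sub>E carrier A" using lin_span_closed[OF orbit_functions_PiE] by blast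
    show "E \<subseteq> lin_span B E" using lin_span_superset[OF E] by blast
    show "lin_span B E \<subseteq> E"
    proof
      fix F assume "F \<in> lin_span B E"
      then show "F \<in> E"
        using lin_span_linear_image[OF E, of F "\<lambda>F. F" orbit_functions]
          lin_span_smult_add[OF orbit_functions_PiE] lin_span_zero by blast
    qed
  qed
  have "norm_closure (tensor_C A U1) E = carrier (tensor_C A U1)"
  proof (rule dense_in_tensor[OF _ span])
    show "E \<subseteq> C_fun" using lin_span_C_fun[OF orbit_functions_C_fun] by blast
    fix a and f :: "complex \<Rightarrow> complex" and e :: real
    assume a: "a \<in> carrier A" and f: "continuous_on U1 f" and e: "0 < e"
    \<comment> \<open>Real and imaginary part contribute an error of \<open>d\<close> each, so
      \<open>2 * d * cnorm A a\<close> must not exceed \<open>e\<close>; adding 1 to the norm allows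
      \<open>a\<close> to be zero.\<close>
    define d where "d = e / (2 * (cnorm A a + 1))"
    have d: "0 < d" using e a by (simp add: d_def add_nonneg_pos)
    obtain g where g: "real_polynomial_function g" "\<And>w. w \<in> U1 \<Longrightarrow> \<bar>Re (f w) - g w\<bar> < d"
      using Stone_Weierstrass_real_polynomial_function[OF compact, of "\<lambda>w. Re (f w)" d] d f
      by (auto intro: continuous_intros)
    obtain h where h: "real_polynomial_function h" "\<And>w. w \<in> U1 \<Longrightarrow> \<bar>Im (f w) - h w\<bar> < d"
      using Stone_Weierstrass_real_polynomial_function[OF compact, of "\<lambda>w. Im (f w)" d] d f
      by (auto intro: continuous_intros)
    let ?k = "\<lambda>w. \<i> * of_real (h w) + of_real (g w)"
    have k: "scalar ?k \<in> E"
      by (rule scalar_smult_add[OF scalar_polynomial[OF id cnj h(1)] scalar_polynomial[OF id cnj g(1)]])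
    have "(\<lambda>w\<in>U1. ?k w \<odot> a) = (\<lambda>w\<in>U1. a \<otimes> scalar ?k w)"
      using a by (auto simp: fun_eq_iff smult_mult_right)
    then have "(\<lambda>w\<in>U1. ?k w \<odot> a) \<in> E" using lmult_mem[OF k a] by simp
    moreover have "cnorm A (f w \<odot> a \<ominus> (\<lambda>w\<in>U1. ?k w \<odot> a) w) \<le> e" if w: "w \<in> U1" for w
    proof -
      have "cmod (f w - ?k w) \<le> \<bar>Re (f w - ?k w)\<bar> + \<bar>Im (f w - ?k w)\<bar>" by (rule cmod_le)
      also have "\<dots> \<le> 2 * d" using g(2)[OF w] h(2)[OF w] by simp
      finally have "cmod (f w - ?k w) * cnorm A a \<le> 2 * d * (cnorm A a + 1)"
        using a d by (intro mult_mono) auto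
      moreover have "cnorm A a + 1 \<noteq> 0" using cnorm_nonneg[OF a] by linarith
      then have "2 * d * (cnorm A a + 1) = e" by (simp add: d_def field_simps)
      ultimately show ?thesis using w a by (simp flip: smult_diff_left add: cnorm_smult)
    qed
    ultimately show "\<exists>H\<in>E. \<forall>w\<in>U1. cnorm A (f w \<odot> a \<ominus> H w) \<le> e" by blast
  qed
  then show ?thesis
    using action circle_coaction
    by (simp add: free_circle_action_def free_coaction_def ellwood_image_eq)
qed

end

section \<open>The quantum sphere\<close>

lemma UNIV_gen: "(UNIV :: gen set) = {Z1, Z2, Z3, Z4}"
  using gen.exhaust by blast

lemma idx_less_sets:
  "{j. idx j < idx Z1} = {}" "{j. idx j < idx Z2} = {Z1}" "{j. idx j < idx Z3} = {Z1, Z2}"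
  "{j. idx j < idx Z4} = {Z1, Z2, Z3}"
proof -
  have "idx j < idx Z2 \<longleftrightarrow> j = Z1" "idx j < idx Z3 \<longleftrightarrow> j = Z1 \<or> j = Z2"
    "idx j < idx Z4 \<longleftrightarrow> j = Z1 \<or> j = Z2 \<or> j = Z3" "\<not> idx j < idx Z1" for j
    by (cases j; simp)+
  then show "{j. idx j < idx Z1} = {}" "{j. idx j < idx Z2} = {Z1}"
    "{j. idx j < idx Z3} = {Z1, Z2}" "{j. idx j < idx Z4} = {Z1, Z2, Z3}" by blast+
qed

section \<open>Algebraic consequences of the sphere relations\<close>

abbreviation z :: "gen \<Rightarrow> gen free_star" where "z \<equiv> free_gen"
abbreviation zs :: "gen \<Rightarrow> gen free_star" where "zs j \<equiv> free_adj (free_gen j)"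

definition commutator_relator :: "real \<Rightarrow> gen \<Rightarrow> gen free_star" where
  "commutator_relator q k = zs k * z k - (z k * zs k +
     free_scale (of_real (1 - q\<^sup>2)) (\<Sum>j\<in>{j. idx j < idx k}. z j * zs j))"

definition sphere_relator :: "gen free_star" where
  "sphere_relator = (\<Sum>k\<in>UNIV. z k * zs k) - 1"

lemma relators_mem:
  "commutator_relator q k \<in> sphere7_relators q" "sphere_relator \<in> sphere7_relators q"
  unfolding sphere7_relators_def commutator_relator_def sphere_relator_def Let_def by blast+

text \<open>With the relators kept on the right, these are identities in the free algebra, so every
  seminorm killing the relators annihilates the left sides. The coefficients make each
  \<open>z\<^sub>j z\<^sub>j\<^sup>*\<close> occur with total coefficient one after reordering; for
  \<open>j = 1\<close> in the second identity the count is
  \<open>q\<^sup>4 + q\<^sup>2 (1 - q\<^sup>2) + (1 - q\<^sup>2) = 1\<close>.\<close>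

lemma sum_identities:
  shows "free_scale (of_real (q\<^sup>2)) (zs Z1 * z Z1) + free_scale (of_real (q\<^sup>2)) (z Z2 * zs Z2) +
      free_scale (of_real (q\<^sup>2)) (z Z3 * zs Z3) + zs Z4 * z Z4 - 1 =
      free_scale (of_real (q\<^sup>2)) (commutator_relator q Z1) + commutator_relator q Z4 + sphere_relator"
    and "free_scale (of_real (q ^ 4)) (z Z1 * zs Z1) + free_scale (of_real (q\<^sup>2)) (zs Z2 * z Z2) +
      zs Z3 * z Z3 + z Z4 * zs Z4 - 1 =
      free_scale (of_real (q\<^sup>2)) (commutator_relator q Z2) + commutator_relator q Z3 + sphere_relator"
  unfolding commutator_relator_def sphere_relator_def UNIV_gen idx_less_sets
  by (intro poly_mapping_eqI;
      simp add: lookup_add lookup_minus lookup_free_scale algebra_simps power2_eq_square power4_eq_xxxx)+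

text \<open>The sphere relator trades the sum over indices below \<open>k\<close> for 1 minus the
  sum over the indices from \<open>k\<close> on; the \<open>k\<close>-th term of the latter lowers
  the coefficient of \<open>z\<^sub>k z\<^sub>k\<^sup>*\<close> from 1 to \<open>q\<^sup>2\<close>.
  The case \<open>k = 1\<close> is the sphere relation itself.\<close>

lemma reduced_commutators:
  shows "zs Z4 * z Z4 = free_scale (of_real (q\<^sup>2)) (z Z4 * zs Z4) + free_scale (of_real (1 - q\<^sup>2)) 1 +
      commutator_relator q Z4 + free_scale (of_real (1 - q\<^sup>2)) sphere_relator"
    and "zs Z3 * z Z3 = free_scale (of_real (q\<^sup>2)) (z Z3 * zs Z3) +
      free_scale (of_real (1 - q\<^sup>2)) (1 - z Z4 * zs Z4) +
      commutator_relator q Z3 + free_scale (of_real (1 - q\<^sup>2)) sphere_relator"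
    and "zs Z2 * z Z2 = free_scale (of_real (q\<^sup>2)) (z Z2 * zs Z2) +
      free_scale (of_real (1 - q\<^sup>2)) (1 - z Z3 * zs Z3 - z Z4 * zs Z4) +
      commutator_relator q Z2 + free_scale (of_real (1 - q\<^sup>2)) sphere_relator"
    and "z Z1 * zs Z1 = 1 - z Z2 * zs Z2 - z Z3 * zs Z3 - z Z4 * zs Z4 + sphere_relator"
  unfolding commutator_relator_def sphere_relator_def UNIV_gen idx_less_sets
  by (intro poly_mapping_eqI;
      simp add: lookup_add lookup_minus lookup_free_scale algebra_simps power2_eq_square)+

text \<open>Subtracting \<open>q\<^sup>2 z\<^sub>k z\<^sub>k\<^sup>*\<close> in the commutation relation leaves terms \<open>z\<^sub>j z\<^sub>j\<^sup>*\<close> with \<open>j > k\<close>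
  only, which bounds the norms of the generators from \<open>z\<^sub>4\<close> downwards without any use of
  positivity.\<close>

lemma sphere7_gen_bound:
  assumes q: "0 < q" "q < 1" and s: "cstar_seminorm s" and R: "\<forall>r\<in>sphere7_relators q. s r = 0"
  shows "s (z k) \<le> 3"
proof -
  note sD = cstar_seminormD[OF s] and s0 = cstar_seminorm_nonneg[OF s]
  have rel: "s (commutator_relator q k) = 0" "s sphere_relator = 0" for k
    using R relators_mem by auto
  have q2: "0 < 1 - q\<^sup>2" using q by (simp add: power_less_one_iff)
  \<comment> \<open>Both \<open>zs k * z k\<close> and \<open>z k * zs k\<close> have seminorm
    \<open>(s (z k))\<^sup>2\<close>. The resulting inequality
    \<open>x \<le> q\<^sup>2 x + (1 - q\<^sup>2) s g\<close> can be solved for \<open>x\<close>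
    because \<open>q\<^sup>2 < 1\<close>.\<close>
  have step: "(s (z k))\<^sup>2 \<le> s g"
    if eq: "zs k * z k = free_scale (of_real (q\<^sup>2)) (z k * zs k) + free_scale (of_real (1 - q\<^sup>2)) g +
      commutator_relator q k + free_scale (of_real (1 - q\<^sup>2)) sphere_relator" for k g
  proof -
    have "(s (z k))\<^sup>2 = s (zs k * z k)" by (simp add: sD)
    also have "\<dots> \<le> s (free_scale (of_real (q\<^sup>2)) (z k * zs k)) + s (free_scale (of_real (1 - q\<^sup>2)) g) +
      s (commutator_relator q k) + s (free_scale (of_real (1 - q\<^sup>2)) sphere_relator)"
      unfolding eq by (meson sD(1) order_trans add_right_mono)
    also have "\<dots> = q\<^sup>2 * (s (z k))\<^sup>2 + (1 - q\<^sup>2) * s g"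
      using q2 rel by (simp only: sD(2) cstar_seminorm_adj_right[OF s] norm_of_real) simp
    finally have "(1 - q\<^sup>2) * (s (z k))\<^sup>2 \<le> (1 - q\<^sup>2) * s g" by (simp add: algebra_simps)
    then show ?thesis using q2 by simp
  qed
  note one = cstar_seminorm_one[OF s] and diff = cstar_seminorm_diff[OF s]
    and zz = cstar_seminorm_adj_right[OF s]
  \<comment> \<open>Each bound is 1 plus the bounds for the higher indices: 1, then 1 + 1 = 2, 1 + 2
    + 1 = 4 and 1 + 4 + 2 + 1 = 8. The final constant 3 is chosen because 8 is at most 9.\<close>
  have z4: "(s (z Z4))\<^sup>2 \<le> 1" using step[OF reduced_commutators(1)] one by simp
  have z3: "(s (z Z3))\<^sup>2 \<le> 2"
    using step[OF reduced_commutators(2)] one diff[of 1 "z Z4 * zs Z4"] z4 by (simp add: zz)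
  have z2: "(s (z Z2))\<^sup>2 \<le> 4"
    using step[OF reduced_commutators(3)] one diff[of "1 - z Z3 * zs Z3" "z Z4 * zs Z4"]
      diff[of 1 "z Z3 * zs Z3"] z3 z4 by (simp add: zz)
  have "(s (z Z1))\<^sup>2 = s (1 - z Z2 * zs Z2 - z Z3 * zs Z3 - z Z4 * zs Z4 + sphere_relator)"
    by (simp flip: zz add: reduced_commutators(4))
  also have "\<dots> \<le> 8"
    using sD(1)[of "1 - z Z2 * zs Z2 - z Z3 * zs Z3 - z Z4 * zs Z4" sphere_relator]
      diff[of "1 - z Z2 * zs Z2 - z Z3 * zs Z3" "z Z4 * zs Z4"]
      diff[of "1 - z Z2 * zs Z2" "z Z3 * zs Z3"] diff[of 1 "z Z2 * zs Z2"] one rel z2 z3 z4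
    by (simp add: zz)
  finally have z1: "(s (z Z1))\<^sup>2 \<le> 8" .
  have "(s (z k))\<^sup>2 \<le> 3\<^sup>2" using z1 z2 z3 z4 by (cases k) auto
  then show ?thesis by (rule power2_le_imp_le) simp
qed

lemma sphere7_bounded:
  assumes q: "0 < q" "q < 1"
  shows "\<exists>C. \<forall>s. cstar_seminorm s \<and> (\<forall>r\<in>sphere7_relators q. s r = 0) \<longrightarrow> s f \<le> C"
  using cstar_seminorm_bounded[of "\<lambda>_. 3" f] sphere7_gen_bound[OF q] by blast

section \<open>The circle action\<close>

definition sphere7_weight :: "complex \<Rightarrow> gen \<Rightarrow> complex" where
  "sphere7_weight w j = (if j \<in> {Z1, Z4} then w else cnj w)"

text \<open>Each relator is homogeneous: its monomials share one weight, which is the scalar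
  \<open>c\<close>. Modulus one enters through the products
  \<open>z\<^sub>k z\<^sub>k\<^sup>*\<close> and \<open>z\<^sub>k\<^sup>* z\<^sub>k\<close>, which
  then have weight 1 like the constant term.\<close>

lemma gauge_relator:
  assumes u: "\<And>j. cmod (u j) = 1" and r: "r \<in> sphere7_relators q"
  obtains c where "gauge u r = free_scale c r"
proof -
  have uu: "u j * cnj (u j) = 1" for j using u[of j] by (simp add: complex_norm_square[symmetric])
  have gz: "gauge u (z i * z j) = free_scale (u i * u j) (z i * z j)"
    "gauge u (zs i * z j) = free_scale (cnj (u i) * u j) (zs i * z j)"
    "gauge u (z j * zs i) = free_scale (cnj (u i) * u j) (z j * zs i)" for i j
    by (simp_all add: gauge_mult gauge_gen gauge_adj free_adj_scale free_scale_mult_left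
        free_scale_mult_right free_scale_scale mult.commute)
  have zz: "gauge u (z k * zs k) = z k * zs k" "gauge u (zs k * z k) = zs k * z k" for k
    using uu[of k] by (simp_all add: gz mult.commute)
  consider i j where "r = z i * z j - free_scale (of_real q) (z j * z i)"
    | i j where "r = zs j * z i - free_scale (of_real q) (z i * zs j)"
    | k where "r = commutator_relator q k" | "r = sphere_relator"
    using r unfolding sphere7_relators_def commutator_relator_def sphere_relator_def Let_def by blast
  then show ?thesis
  proof cases
    case (1 i j)
    then show ?thesis
      by (intro that[of "u i * u j"])
         (simp add: gauge_diff gauge_scale gz free_scale_diff_right free_scale_scale mult_ac)
  next
    case (2 i j)
    then show ?thesis
      by (intro that[of "cnj (u j) * u i"])
         (simp add: gauge_diff gauge_scale gz free_scale_diff_right free_scale_scale mult_ac)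
  next
    case (3 k)
    then show ?thesis
      by (intro that[of 1]) (simp add: commutator_relator_def gauge_diff gauge_add gauge_scale gauge_sum zz)
  next
    case 4
    then show ?thesis
      by (intro that[of 1]) (simp add: sphere_relator_def gauge_diff gauge_sum zz)
  qed
qed

locale sphere7 =
  fixes q :: real
  assumes q: "0 < q" "q < 1"
begin

sublocale univ_completion "sphere7_relators q"
  by unfold_locales (rule cstar_seminorm_univ_norm[OF sphere7_bounded[OF q]])

abbreviation (input) R where "R \<equiv> sphere7_relators q"

lemma p_relator: "r \<in> R \<Longrightarrow> univ_norm R r = 0"
  by (rule order_antisym[OF univ_norm_least cstar_seminorm_nonneg[OF seminorm]]) simp

text \<open>A seminorm that kills the relators still does so after being pulled back along
  \<open>gauge u\<close>, which only scales them. The pullback therefore competes in the supremum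
  that defines \<open>univ_norm\<close>. This contractivity carries the gauge maps over to the
  completion.\<close>

lemma p_gauge_le:
  assumes u: "\<And>j. cmod (u j) = 1"
  shows "univ_norm R (gauge u f) \<le> univ_norm R f"
proof (rule univ_norm_least)
  fix s assume s: "cstar_seminorm s" "\<forall>r\<in>R. s r = 0"
  have "s (gauge u r) = 0" if "r \<in> R" for r
  proof -
    obtain c where "gauge u r = free_scale c r" using gauge_relator[OF u \<open>r \<in> R\<close>] .
    then show ?thesis using s that by (simp add: cstar_seminormD)
  qed
  then show "s (gauge u f) \<le> univ_norm R f"
    using univ_norm_upper[OF sphere7_bounded[OF q] cstar_seminorm_gauge[OF s(1)]] by blast
qed

lemma cmod_weight: "w \<in> U1 \<Longrightarrow> cmod (sphere7_weight w j) = 1"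
  by (simp add: sphere7_weight_def)

definition action :: "complex \<Rightarrow> (nat \<Rightarrow> gen free_star) set \<Rightarrow> (nat \<Rightarrow> gen free_star) set" where
  "action w a = (\<Union>X\<in>a. univ_class R (\<lambda>n. gauge (sphere7_weight w) (X n)))"

lemma p_gauge_diff_le:
  "w \<in> U1 \<Longrightarrow> univ_norm R (gauge (sphere7_weight w) f - gauge (sphere7_weight w) g) \<le> univ_norm R (f - g)"
  using p_gauge_le[of "sphere7_weight w" "f - g"] by (simp add: cmod_weight gauge_diff)

lemma Cauchy_gauge [simp]:
  assumes X: "X \<in> univ_Cauchy R" and w: "w \<in> U1"
  shows "(\<lambda>n. gauge (sphere7_weight w) (X n)) \<in> univ_Cauchy R"
  using p_gauge_diff_le[OF w] by (intro Cauchy_lipschitz[OF X, of _ 1]) simp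

lemma action_class:
  assumes X: "X \<in> univ_Cauchy R" and w: "w \<in> U1"
  shows "action w (univ_class R X) = univ_class R (\<lambda>n. gauge (sphere7_weight w) (X n))"
  unfolding action_def
  by (rule class_ext[OF X]) (rule null_mono[OF _ p_gauge_diff_le[OF w]])

lemma action_star_hom:
  assumes w: "w \<in> U1"
  shows "star_hom (univ_cstar R) (univ_cstar R) (action w)"
  unfolding star_hom_def
  by (intro conjI ballI allI ring_hom_memI; (elim carrierE)?)
     (use w in \<open>simp_all add: class_simps action_class gauge_add gauge_mult gauge_scale gauge_adj\<close>)

lemma action_contractive:
  assumes w: "w \<in> U1" and a: "a \<in> carrier (univ_cstar R)" and b: "b \<in> carrier (univ_cstar R)"
  shows "cnorm (univ_cstar R) (action w a \<ominus>\<^bsub>univ_cstar R\<^esub> action w b) \<le> cnorm (univ_cstar R) (a \<ominus>\<^bsub>univ_cstar R\<^esub> b)"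
  using a b
proof (elim carrierE)
  fix X Y assume C: "X \<in> univ_Cauchy R" "Y \<in> univ_Cauchy R" and eq: "a = univ_class R X" "b = univ_class R Y"
  show ?thesis
    using C w p_gauge_diff_le[OF w]
    by (auto simp: eq action_class minus_class intro!: LIMSEQ_le[OF cnorm_class cnorm_class])
qed

text \<open>On a single word the gauge map is multiplication by \<open>word_weight\<close>, a finite
  product of factors \<open>v\<close> and \<open>cnj v\<close> and hence continuous in
  \<open>v\<close>; sums follow from the triangle inequality.\<close>

lemma gauge_continuous:
  "((\<lambda>v. univ_norm R (gauge (sphere7_weight v) f - gauge (sphere7_weight w) f)) \<longlongrightarrow> 0) (at w within U1)"
proof (induction f rule: free_star_induct)
  case (single x c)
  have lim: "((\<lambda>v. word_weight (sphere7_weight v) x) \<longlongrightarrow> word_weight (sphere7_weight w) x) (at w within U1)"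
  proof (induction x)
    case (Cons l x)
    obtain j b where l: "l = (j, b)" by fastforce
    have "((\<lambda>v. sphere7_weight v j) \<longlongrightarrow> sphere7_weight w j) (at w within U1)"
      by (auto simp: sphere7_weight_def intro!: tendsto_intros)
    then have "((\<lambda>v. if b then cnj (sphere7_weight v j) else sphere7_weight v j) \<longlongrightarrow>
        (if b then cnj (sphere7_weight w j) else sphere7_weight w j)) (at w within U1)"
      by (cases b) (auto intro!: tendsto_intros)
    from tendsto_mult[OF this Cons] show ?case by (simp add: word_weight_def l)
  qed (simp add: word_weight_def)
  have eq: "univ_norm R (gauge (sphere7_weight v) (Poly_Mapping.single x c) -
      gauge (sphere7_weight w) (Poly_Mapping.single x c)) =
      cmod (word_weight (sphere7_weight v) x - word_weight (sphere7_weight w) x) *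
        univ_norm R (Poly_Mapping.single x c)" for v
  proof -
    have "gauge (sphere7_weight v) (Poly_Mapping.single x c) - gauge (sphere7_weight w) (Poly_Mapping.single x c) =
      free_scale (word_weight (sphere7_weight v) x - word_weight (sphere7_weight w) x) (Poly_Mapping.single x c)"
      by (simp add: gauge_single free_scale_single single_diff algebra_simps)
    then show ?thesis by (simp add: p_scale)
  qed
  show ?case
    unfolding eq
    by (intro tendsto_mult_left_zero tendsto_norm_zero LIM_zero lim)
next
  case (add f g)
  have "univ_norm R (gauge (sphere7_weight v) (f + g) - gauge (sphere7_weight w) (f + g)) \<le>
    univ_norm R (gauge (sphere7_weight v) f - gauge (sphere7_weight w) f) +
    univ_norm R (gauge (sphere7_weight v) g - gauge (sphere7_weight w) g)" for v
    using p_add[of "gauge (sphere7_weight v) f - gauge (sphere7_weight w) f"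
      "gauge (sphere7_weight v) g - gauge (sphere7_weight w) g"]
    by (simp add: gauge_add algebra_simps)
  then show ?case
    by (intro tendsto_sandwich[OF _ _ tendsto_const tendsto_add_zero[OF add]]) auto
qed

text \<open>Continuity is known on the dense image of the free algebra. It extends to the closure
  because all \<open>action v\<close> are contractive, so the approximation error is uniform in
  \<open>v\<close>.\<close>

lemma action_continuous:
  assumes a: "a \<in> carrier (univ_cstar R)" and w: "w \<in> U1"
  shows "((\<lambda>v. cnorm (univ_cstar R) (action v a \<ominus>\<^bsub>univ_cstar R\<^esub> action w a)) \<longlongrightarrow> 0) (at w within U1)"
proof (rule tendstoI)
  interpret cs: cstar "univ_cstar R" by unfold_locales (rule cstar_algebra_univ)
  fix e :: real assume e: "0 < e"
  obtain f where f: "cnorm (univ_cstar R) (a \<ominus>\<^bsub>univ_cstar R\<^esub> univ_class R (\<lambda>_. f)) < e / 3"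
    using dense[OF a, of "e / 3"] e by auto
  let ?c = "univ_class R (\<lambda>_. f)"
  have cl: "action v x \<in> carrier (univ_cstar R)" if "v \<in> U1" "x \<in> carrier (univ_cstar R)" for v x
    using action_star_hom[OF that(1)] that(2) by (auto simp: star_hom_def dest: ring_hom_closed)
  have "\<forall>\<^sub>F v in at w within U1.
      univ_norm R (gauge (sphere7_weight v) f - gauge (sphere7_weight w) f) < e / 3"
    by (rule order_tendstoD(2)[OF gauge_continuous]) (use e in simp)
  moreover have "\<forall>\<^sub>F v in at w within U1. v \<in> U1" by (simp add: eventually_at_filter)
  ultimately show "\<forall>\<^sub>F v in at w within U1.
      dist (cnorm (univ_cstar R) (action v a \<ominus>\<^bsub>univ_cstar R\<^esub> action w a)) 0 < e"
  proof eventually_elim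
    case (elim v)
    have "cnorm (univ_cstar R) (action v ?c \<ominus>\<^bsub>univ_cstar R\<^esub> action w ?c) < e / 3"
      using elim w by (simp add: action_class minus_class cnorm_const)
    moreover have "cnorm (univ_cstar R) (action v a \<ominus>\<^bsub>univ_cstar R\<^esub> action v ?c) < e / 3"
      using action_contractive[OF elim(2) a, of ?c] f by simp
    moreover have "cnorm (univ_cstar R) (action w ?c \<ominus>\<^bsub>univ_cstar R\<^esub> action w a) < e / 3"
      using action_contractive[OF w _ a, of ?c] f a by (simp add: cs.cnorm_diff_commute)
    moreover have "cnorm (univ_cstar R) (action v a \<ominus>\<^bsub>univ_cstar R\<^esub> action w a) \<le>
      cnorm (univ_cstar R) (action v a \<ominus>\<^bsub>univ_cstar R\<^esub> action v ?c) +
      cnorm (univ_cstar R) (action v ?c \<ominus>\<^bsub>univ_cstar R\<^esub> action w a)"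
      using elim a w by (intro cs.cnorm_triangle cl) auto
    moreover have "cnorm (univ_cstar R) (action v ?c \<ominus>\<^bsub>univ_cstar R\<^esub> action w a) \<le>
      cnorm (univ_cstar R) (action v ?c \<ominus>\<^bsub>univ_cstar R\<^esub> action w ?c) +
      cnorm (univ_cstar R) (action w ?c \<ominus>\<^bsub>univ_cstar R\<^esub> action w a)"
      using elim a w by (intro cs.cnorm_triangle cl) auto
    moreover have "0 \<le> cnorm (univ_cstar R) (action v a \<ominus>\<^bsub>univ_cstar R\<^esub> action w a)"
      using elim a w by (intro cs.cnorm_nonneg cs.minus_closed cl)
    ultimately show ?case by simp
  qed
qed

text \<open>Existence is what keeps the freeness claim about all such actions from being vacuous.
  The group law comes from the weights being multiplicative in \<open>w\<close>.\<close>

lemma sphere7_action_action: "sphere7_action q action"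
  unfolding sphere7_action_def circle_action_def C_sphere7_def
proof (intro conjI ballI allI cstar_algebra_univ action_star_hom action_continuous)
  have weight_one: "sphere7_weight 1 = (\<lambda>_. 1)" by (auto simp: sphere7_weight_def)
  fix a assume "a \<in> carrier (univ_cstar R)"
  then obtain X where X: "X \<in> univ_Cauchy R" "a = univ_class R X" by (rule carrierE)
  show "action 1 a = a" using X by (simp add: action_class weight_one)
  fix v w :: complex assume vw: "v \<in> U1" "w \<in> U1"
  have "sphere7_weight (v * w) = (\<lambda>j. sphere7_weight v j * sphere7_weight w j)"
    by (auto simp: sphere7_weight_def)
  then show "action (v * w) a = action v (action w a)"
    using X vw by (simp add: action_class norm_mult gauge_gauge)
next
  fix w j assume "w \<in> U1"
  then show "action w (zgen q j) =
    (if j \<in> {Z1, Z4} then w \<odot>\<^bsub>univ_cstar R\<^esub> zgen q j else cnj w \<odot>\<^bsub>univ_cstar R\<^esub> zgen q j)"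
    by (auto simp: zgen_def univ_gen_def action_class class_simps gauge_gen sphere7_weight_def)
qed

section \<open>Freeness of the action on the quantum sphere\<close>

lemma const_eqI: "univ_norm R (f - g) = 0 \<Longrightarrow> univ_class R (\<lambda>_. f) = univ_class R (\<lambda>_. g)"
  by (rule class_eqI) simp

lemma const_sum_identities:
  "univ_class R (\<lambda>_. free_scale (of_real (q\<^sup>2)) (zs Z1 * z Z1) + free_scale (of_real (q\<^sup>2)) (z Z2 * zs Z2) +
      free_scale (of_real (q\<^sup>2)) (z Z3 * zs Z3) + zs Z4 * z Z4) = \<one>\<^bsub>univ_cstar R\<^esub>"
  "univ_class R (\<lambda>_. free_scale (of_real (q ^ 4)) (z Z1 * zs Z1) + free_scale (of_real (q\<^sup>2)) (zs Z2 * z Z2) +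
      zs Z3 * z Z3 + z Z4 * zs Z4) = \<one>\<^bsub>univ_cstar R\<^esub>"
proof -
  have "univ_norm R (free_scale c (commutator_relator q k) + commutator_relator q j + sphere_relator) = 0" for c k j
  proof -
    have "univ_norm R (free_scale c (commutator_relator q k) + commutator_relator q j + sphere_relator) \<le>
      univ_norm R (free_scale c (commutator_relator q k)) + univ_norm R (commutator_relator q j) + univ_norm R sphere_relator"
      by (meson p_add order_trans add_right_mono)
    also have "\<dots> = 0" by (simp add: p_scale p_relator relators_mem)
    finally show ?thesis by (simp add: order_antisym)
  qed
  then show "univ_class R (\<lambda>_. free_scale (of_real (q\<^sup>2)) (zs Z1 * z Z1) + free_scale (of_real (q\<^sup>2)) (z Z2 * zs Z2) +
      free_scale (of_real (q\<^sup>2)) (z Z3 * zs Z3) + zs Z4 * z Z4) = \<one>\<^bsub>univ_cstar R\<^esub>"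
    "univ_class R (\<lambda>_. free_scale (of_real (q ^ 4)) (z Z1 * zs Z1) + free_scale (of_real (q\<^sup>2)) (zs Z2 * z Z2) +
      zs Z3 * z Z3 + z Z4 * zs Z4) = \<one>\<^bsub>univ_cstar R\<^esub>"
    unfolding one_eq by (auto intro!: const_eqI simp only: sum_identities)
qed

text \<open>The values of \<open>\<mu>\<close> on the generators and, through the involution, on
  their adjoints are all that enters, so the argument applies to any action with these values and
  does not pass through their uniqueness.\<close>

lemma free_sphere7_action:
  assumes \<mu>: "sphere7_action q \<mu>"
  shows "free_circle_action (C_sphere7 q) \<mu>"
proof -
  let ?A = "univ_cstar R"
  interpret act: circle_action_locale ?A \<mu>
    using \<mu> by unfold_locales (simp add: sphere7_action_def C_sphere7_def)
  let ?c = "\<lambda>f. univ_class R (\<lambda>_. f)"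
  have gen: "\<mu> w (?c (z j)) = ?c (free_scale (sphere7_weight w j) (z j))" if "w \<in> U1" for w j
  proof -
    have "\<mu> w (?c (z j)) = sphere7_weight w j \<odot>\<^bsub>?A\<^esub> ?c (z j)"
      using \<mu> that unfolding sphere7_action_def sphere7_weight_def C_sphere7_def zgen_def univ_gen_def by auto
    then show ?thesis by (simp add: class_simps)
  qed
  have adj_gen: "\<mu> w (?c (zs j)) = ?c (free_scale (cnj (sphere7_weight w j)) (zs j))" if w: "w \<in> U1" for w j
  proof -
    have "\<mu> w (adj ?A (?c (z j))) = adj ?A (\<mu> w (?c (z j)))" using w by (intro act.action_adj) auto
    then show ?thesis using w by (simp add: gen class_simps free_adj_scale)
  qed
  \<comment> \<open>These are the orbit functions with left factor \<open>free_scale b f\<close> and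
    right factor a generator or its adjoint; the action on the right factor appears as a scalar in
    front.\<close>
  have summand: "(\<lambda>w\<in>U1. ?c (free_scale (sphere7_weight w j) (free_scale b (f * z j)))) \<in> act.E"
    "(\<lambda>w\<in>U1. ?c (free_scale (cnj (sphere7_weight w j)) (free_scale b (f * zs j)))) \<in> act.E" for b f j
  proof -
    have "(\<lambda>w\<in>U1. ?c (free_scale (sphere7_weight w j) (free_scale b (f * z j)))) =
        (\<lambda>w\<in>U1. ?c (free_scale b f) \<otimes>\<^bsub>?A\<^esub> \<mu> w (?c (z j)))"
      by (rule restrict_ext) (simp add: gen class_simps free_scale_mult_left free_scale_mult_right)
    then show "(\<lambda>w\<in>U1. ?c (free_scale (sphere7_weight w j) (free_scale b (f * z j)))) \<in> act.E"
      using act.orbit_function_mem[of "?c (free_scale b f)" "?c (z j)"] by simp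
    have "(\<lambda>w\<in>U1. ?c (free_scale (cnj (sphere7_weight w j)) (free_scale b (f * zs j)))) =
        (\<lambda>w\<in>U1. ?c (free_scale b f) \<otimes>\<^bsub>?A\<^esub> \<mu> w (?c (zs j)))"
      by (rule restrict_ext) (simp add: adj_gen class_simps free_scale_mult_left free_scale_mult_right)
    then show "(\<lambda>w\<in>U1. ?c (free_scale (cnj (sphere7_weight w j)) (free_scale b (f * zs j)))) \<in> act.E"
      using act.orbit_function_mem[of "?c (free_scale b f)" "?c (zs j)"] by simp
  qed
  have add: "(\<lambda>w\<in>U1. ?c (f w + g w)) \<in> act.E"
    if "(\<lambda>w\<in>U1. ?c (f w)) \<in> act.E" "(\<lambda>w\<in>U1. ?c (g w)) \<in> act.E" for f g
  proof -
    have "(\<lambda>w\<in>U1. ?c (f w + g w)) = (\<lambda>w\<in>U1. (\<lambda>w\<in>U1. ?c (f w)) w \<oplus>\<^bsub>?A\<^esub> (\<lambda>w\<in>U1. ?c (g w)) w)"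
      by (auto simp: class_simps fun_eq_iff)
    then show ?thesis using act.lin_span_add[OF act.orbit_functions_PiE that] by simp
  qed
  have "free_circle_action ?A \<mu>"
  proof (rule act.free_if_scalar_mem)
    \<comment> \<open>Weight 1: the right factors are \<open>z\<^sub>1\<close>,
      \<open>z\<^sub>2\<^sup>*\<close>, \<open>z\<^sub>3\<^sup>*\<close>, \<open>z\<^sub>4\<close>.
      The scaling by 1 keeps the last summand in the form of \<open>summand\<close>, which is why
      \<open>free_scale_one\<close> is withheld from simplification.\<close>
    have "(\<lambda>w\<in>U1. ?c (free_scale w (free_scale (of_real (q\<^sup>2)) (zs Z1 * z Z1)) +
        free_scale w (free_scale (of_real (q\<^sup>2)) (z Z2 * zs Z2)) +
        free_scale w (free_scale (of_real (q\<^sup>2)) (z Z3 * zs Z3)) + free_scale w (free_scale 1 (zs Z4 * z Z4)))) \<in> act.E"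
      using summand(1)[of Z1] summand(2)[of Z2] summand(2)[of Z3] summand(1)[of Z4]
      by (intro add) (simp_all add: sphere7_weight_def del: free_scale_one)
    moreover have "w \<odot>\<^bsub>?A\<^esub> \<one>\<^bsub>?A\<^esub> = ?c (free_scale w (free_scale (of_real (q\<^sup>2)) (zs Z1 * z Z1)) +
        free_scale w (free_scale (of_real (q\<^sup>2)) (z Z2 * zs Z2)) +
        free_scale w (free_scale (of_real (q\<^sup>2)) (z Z3 * zs Z3)) + free_scale w (free_scale 1 (zs Z4 * z Z4)))" for w
      unfolding const_sum_identities(1)[symmetric] by (simp add: smult_class free_scale_add_right)
    ultimately show "(\<lambda>w\<in>U1. w \<odot>\<^bsub>?A\<^esub> \<one>\<^bsub>?A\<^esub>) \<in> act.E" by simp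
    \<comment> \<open>Weight -1: the right factors are now \<open>z\<^sub>1\<^sup>*\<close>,
      \<open>z\<^sub>2\<close>, \<open>z\<^sub>3\<close>, \<open>z\<^sub>4\<^sup>*\<close>, the
      complementary choice.\<close>
    have "(\<lambda>w\<in>U1. ?c (free_scale (cnj w) (free_scale (of_real (q ^ 4)) (z Z1 * zs Z1)) +
        free_scale (cnj w) (free_scale (of_real (q\<^sup>2)) (zs Z2 * z Z2)) +
        free_scale (cnj w) (free_scale 1 (zs Z3 * z Z3)) + free_scale (cnj w) (free_scale 1 (z Z4 * zs Z4)))) \<in> act.E"
      using summand(2)[of Z1] summand(1)[of Z2] summand(1)[of Z3] summand(2)[of Z4]
      by (intro add) (simp_all add: sphere7_weight_def del: free_scale_one)
    moreover have "cnj w \<odot>\<^bsub>?A\<^esub> \<one>\<^bsub>?A\<^esub> = ?c (free_scale (cnj w) (free_scale (of_real (q ^ 4)) (z Z1 * zs Z1)) +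
        free_scale (cnj w) (free_scale (of_real (q\<^sup>2)) (zs Z2 * z Z2)) +
        free_scale (cnj w) (free_scale 1 (zs Z3 * z Z3)) + free_scale (cnj w) (free_scale 1 (z Z4 * zs Z4)))" for w
      unfolding const_sum_identities(2)[symmetric] by (simp add: smult_class free_scale_add_right)
    ultimately show "(\<lambda>w\<in>U1. cnj w \<odot>\<^bsub>?A\<^esub> \<one>\<^bsub>?A\<^esub>) \<in> act.E" by simp
  qed
  then show ?thesis by (simp add: C_sphere7_def)
qed

end

theorem proposition3p4:
  fixes q :: real
  assumes "0 < q" and "q < 1"
  shows "(\<exists>\<mu>. sphere7_action q \<mu>) \<and>
    (\<forall>\<mu>. sphere7_action q \<mu> \<longrightarrow> free_circle_action (C_sphere7 q) \<mu>)"
proof -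
  interpret sphere7 q using assms by unfold_locales
  show ?thesis using sphere7_action_action free_sphere7_action by blast
qed

end
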